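(* Let $G$ be a $3$-dimensional non-unimodular Lie group with Lie algebra $\mathfrak{g}$ and unimodular kernel $\mathfrak{u}$, $g$ a left-invariant pseudo-Riemannian metric with $g|_{\mathfrak{u}\times\mathfrak{u}}$ non-degenerate, and $(v_a)$ a $g$-orthonormal basis of $\mathfrak{g}$ with $v_1,v_3\in\mathfrak{u}$, $\epsilon_a=g(v_a,v_a)$, and $$[v_1,v_3]=0,\quad[v_2,v_1]=\epsilon_1\lambda v_1+\epsilon_3\mu v_3,\quad[v_2,v_3]=\epsilon_1\nu v_1+\epsilon_3\rho v_3,\qquad\epsilon_1\lambda+\epsilon_3\rho\neq0.$$ Let $E_{H,F}$ be a Courant algebroid of type $B_3$ over $G$ with left-invariant $H=h\,v_1^*\wedge v_2^*\wedge v_3^*$, $F=\frac12F_{ab}v_a^*\wedge v_b^*$, and $\delta$ a left-invariant divergence operator with $\delta_A=\delta(e_A)$. Put $\tilde\lambda:=\delta_2+\epsilon_1\lambda$, $\tilde\rho:=\delta_2+\epsilon_3\rho$. The odd generalized Einstein metrics $E_-=\{X-g(X)\mid X\in TG\}$ with divergence $\delta$ of case 7 (defined in the context) form two classes: they are exactly those with $F_{13}=h=\delta_0=\delta_1=\delta_3=\delta_4=\delta_6=0$, $\delta_2=\delta_5$, whose constants satisfy one of the following conditions: i) $\mu=\nu$, $\mu\tilde\lambda\neq0$, $\delta_2=\tilde\lambda+\epsilon_1\epsilon_3\frac{\mu^2}{\tilde\lambda}$ and $$(F_{12})^2=-\Big(\frac\mu{\tilde\lambda}\Big)^2(\epsilon_3\tilde\lambda^2+\epsilon_1\mu^2)>0;$$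 ii) $\tilde\lambda^2\neq\nu^2$, $\mu\tilde\lambda\neq0$, $\epsilon_3=-\epsilon_1$, $\delta_2=\frac\epsilon2(\nu-\mu)$ (where $\epsilon\in\{\pm1\}$) and $$\tilde\lambda^2+\frac\epsilon2(\nu-\mu)\tilde\lambda-\mu\nu=0,\qquad(F_{12})^2=\epsilon_1(\nu-\mu)\nu\Big(\epsilon\frac\mu{2\tilde\lambda}-1\Big)>0;$$ together with, for both families, $$F_{23}=F_{12}\epsilon_3\frac{\tilde\lambda}\nu,\qquad\tilde\rho=\epsilon_1\epsilon_3\frac{\mu\nu}{\tilde\lambda}.$$ For the family i), $\mathfrak{g}$ is isomorphic to $\tau_2(\mathbb{R})\oplus\mathbb{R}$. For the family ii), $\mathfrak{g}$ is isomorphic to $\tau_{3,\frac12}(\mathbb{R})$.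
   Context: Case 7. We say that $(E_-,\delta)$ is of case 7 if $\mu,\nu,F_{12},F_{23}$ and $\epsilon_1\lambda+\epsilon_3\rho$ are all non-zero, $F_{13}=h=\delta_0=\delta_1=\delta_3=\delta_4=\delta_6=0$, $\delta_2=\delta_5$ and the following relations hold (such $E_-$ is then generalized Einstein with divergence $\delta$): $$F_{12}\epsilon_3(\delta_2+\epsilon_1\lambda)=F_{23}\nu,\qquad F_{12}\mu=F_{23}\epsilon_1(\epsilon_3\rho+\delta_2),$$ $$(F_{12})^2=\tfrac{\epsilon_3}2(\nu^2-\mu^2)+\delta_2\lambda,\qquad(F_{23})^2=\tfrac{\epsilon_1}2(\mu^2-\nu^2)+\delta_2\rho,$$ $$\delta_2(\epsilon_1\lambda+\epsilon_3\rho)=-\lambda^2-\tfrac{\epsilon_1\epsilon_3}2(\mu+\nu)^2-\rho^2,$$ $$F_{12}F_{23}=\tfrac{\epsilon_1}2\lambda(\nu-\mu)+\tfrac{\epsilon_3}2\rho(\mu-\nu)-\tfrac{\delta_2}2(\mu+\nu).$$ Here $\lambda,\mu,\nu,\rho,h,F_{ab}\in\mathbb{R}$, $\epsilon_a\in\{\pm1\}$; $\mathfrak{u}=\{x\in\mathfrak{g}\mid\mathrm{tr}\,\mathrm{ad}_x=0\}$; $e_0=1$, $e_a=v_a+g(v_a)$, $e_{a+3}=v_a-g(v_a)$ ($1\le a\le3$, $g(X)=g(X,\cdot)$) is the induced basis of $\tilde E=\mathfrak{g}\oplus\mathfrak{g}^*\oplus\mathbb{R}$, and a left-invariant divergence operator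 is an element $\delta\in\tilde E^*$. $\mathfrak{g}$ is the semi-direct product $\mathbb{R}\ltimes_{\mathbf A}\mathbb{R}^2$ (generator of $\mathbb{R}$ acting on abelian $\mathbb{R}^2$ by $\mathbf A$); $\tau_2(\mathbb{R})\oplus\mathbb{R}$ corresponds to $\mathbf A=\mathrm{diag}(1,0)$ and $\tau_{3,\frac12}(\mathbb{R})$ to $\mathbf A=\mathrm{diag}(1,\frac12)$. Background: $E_{H,F}=TG\oplus T^*G\oplus\mathbb{R}$ is the Courant algebroid with $dF=0$, scalar product $\langle X+\xi+\lambda,Y+\eta+\mu\rangle=\frac12(\xi(Y)+\eta(X))+\lambda\mu$ and bracket $[X+\xi+\lambda,Y+\eta+\mu]_{H,F}=\mathcal{L}_X(Y+\eta)-i_Yd\xi+2\mu d\lambda+i_Xi_YH-2(\mu i_XF-\lambda i_YF)+X(\mu)-Y(\lambda)+F(X,Y)$, with anchor $\pi$ the projection to $TG$. $E_-$ is generalized Einstein with divergence $\delta$ if $\mathrm{tr}(E_\pm\ni w\mapsto R^D(w,u)v)=0$ for all $u\in E_\mp$, $v\in E_\pm$, where $E_+=E_-^\perp$, $R^D(u,v)w=D_uD_vw-D_vD_uw-D_{[u,v]_{H,F}}w$, and $D$ is any generalized connection ($D_u(fv)=\pi(u)(f)v+fD_uv$, $\pi(u)\langle v,w\rangle=\langle D_uv,w\rangle+\langle v,D_uw\rangle$) preserving $E_-$, with vanishing torsion $\langle D_uv-D_vu-[u,v]_{H,F},w\rangle+\langle v,D_wu\rangle$ and with $\mathrm{tr}\,Du=\delta(u)$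 (the condition does not depend on $D$). *)

theory Defs
  imports "HOL-Analysis.Analysis"
begin

text \<open>
  Throughout, a real Lie algebra is a finite-dimensional real vector space \<open>'g\<close> with an explicit
  bracket \<open>br\<close>. The class \<open>euclidean_space\<close> only supplies finite dimension and the dual space
  \<open>'g \<Rightarrow>\<^sub>L real\<close>; its inner product is never used. Left-invariant tensors, sections and operators
  on a Lie group are represented by their values on the Lie algebra.
\<close>

section \<open>Lie algebras\<close>

definition lie_algebra :: "('g::real_vector \<Rightarrow> 'g \<Rightarrow> 'g) \<Rightarrow> bool" where
  "lie_algebra br \<longleftrightarrow> bilinear br \<and> (\<forall>x. br x x = 0) \<and>
     (\<forall>x y z. br x (br y z) + br y (br z x) + br z (br x y) = 0)"

definition lie_isomorphic ::
  "('g::real_vector \<Rightarrow> 'g \<Rightarrow> 'g) \<Rightarrow> ('h::real_vector \<Rightarrow> 'h \<Rightarrow> 'h) \<Rightarrow> bool" where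
  "lie_isomorphic br1 br2 \<longleftrightarrow>
     (\<exists>f. linear f \<and> bij f \<and> (\<forall>x y. f (br1 x y) = br2 (f x) (f y)))"

text \<open>Trace of an endomorphism of the subspace \<open>S\<close>; it does not depend on the chosen basis.\<close>

definition trace_on :: "'a::real_vector set \<Rightarrow> ('a \<Rightarrow> 'a) \<Rightarrow> real" where
  "trace_on S f =
     (let B = (SOME B. independent B \<and> span B = S) in \<Sum>b\<in>B. representation B (f b) b)"

definition unimodular_kernel :: "('g::real_vector \<Rightarrow> 'g \<Rightarrow> 'g) \<Rightarrow> 'g set" where
  "unimodular_kernel br = {x. trace_on UNIV (br x) = 0}"

definition semidirect_bracket :: "real^2^2 \<Rightarrow> real \<times> (real^2) \<Rightarrow> real \<times> (real^2) \<Rightarrow> real \<times> (real^2)" where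
  "semidirect_bracket A p q =
     (0, fst p *\<^sub>R (A *v snd q) - fst q *\<^sub>R (A *v snd p))"

definition diag2 :: "real \<Rightarrow> real \<Rightarrow> real^2^2" where
  "diag2 a b = vector [vector [a, 0], vector [0, b]]"

definition tau2_plus_R :: "real \<times> (real^2) \<Rightarrow> real \<times> (real^2) \<Rightarrow> real \<times> (real^2)" where
  "tau2_plus_R = semidirect_bracket (diag2 1 0)"

definition tau3_half :: "real \<times> (real^2) \<Rightarrow> real \<times> (real^2) \<Rightarrow> real \<times> (real^2)" where
  "tau3_half = semidirect_bracket (diag2 1 (1/2))"


section \<open>Left-invariant metrics and forms\<close>

definition nondegenerate_on :: "'g::real_vector set \<Rightarrow> ('g \<Rightarrow> 'g \<Rightarrow> real) \<Rightarrow> bool" where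
  "nondegenerate_on S g \<longleftrightarrow> (\<forall>x\<in>S. (\<forall>y\<in>S. g x y = 0) \<longrightarrow> x = 0)"

definition pseudo_metric :: "('g::real_vector \<Rightarrow> 'g \<Rightarrow> real) \<Rightarrow> bool" where
  "pseudo_metric g \<longleftrightarrow> bilinear g \<and> (\<forall>x y. g x y = g y x) \<and> nondegenerate_on UNIV g"

definition orthonormal_basis :: "('g::real_vector \<Rightarrow> 'g \<Rightarrow> real) \<Rightarrow> (nat \<Rightarrow> 'g) \<Rightarrow> bool" where
  "orthonormal_basis g v \<longleftrightarrow>
     inj_on v {1..3} \<and> independent (v ` {1..3}) \<and> span (v ` {1..3}) = UNIV \<and>
     (\<forall>a\<in>{1..3}. g (v a) (v a) \<in> {1, -1}) \<and>
     (\<forall>a\<in>{1..3}. \<forall>b\<in>{1..3}. a \<noteq> b \<longrightarrow> g (v a) (v b) = 0)"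

definition two_form :: "('g::real_vector \<Rightarrow> 'g \<Rightarrow> real) \<Rightarrow> bool" where
  "two_form F \<longleftrightarrow> bilinear F \<and> (\<forall>x. F x x = 0)"

definition three_form :: "('g::real_vector \<Rightarrow> 'g \<Rightarrow> 'g \<Rightarrow> real) \<Rightarrow> bool" where
  "three_form H \<longleftrightarrow>
     (\<forall>y z. linear (\<lambda>x. H x y z)) \<and> (\<forall>x z. linear (\<lambda>y. H x y z)) \<and> (\<forall>x y. linear (\<lambda>z. H x y z)) \<and>
     (\<forall>x y. H x x y = 0 \<and> H x y x = 0 \<and> H y x x = 0)"

text \<open>The exterior derivative of a left-invariant two-form.\<close>

definition ext_deriv2 ::
  "('g \<Rightarrow> 'g \<Rightarrow> 'g) \<Rightarrow> ('g \<Rightarrow> 'g \<Rightarrow> real) \<Rightarrow> 'g \<Rightarrow> 'g \<Rightarrow> 'g \<Rightarrow> real" where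
  "ext_deriv2 br F x y z = - F (br x y) z + F (br x z) y - F (br y z) x"


section \<open>The Courant algebroid of type \<open>B\<^sub>n\<close> on left-invariant sections\<close>

type_synonym 'g gen = "'g \<times> ('g \<Rightarrow>\<^sub>L real) \<times> real"

fun gen_scalar :: "'g::euclidean_space gen \<Rightarrow> 'g gen \<Rightarrow> real" where
  "gen_scalar (X, \<xi>, l) (Y, \<eta>, m) =
     1/2 * (blinfun_apply \<xi> Y + blinfun_apply \<eta> X) + l * m"

text \<open>
  On left-invariant sections all derivatives of functions vanish and, for left-invariant \<open>Z\<close>,
  \<open>(L\<^sub>X \<eta>)(Z) = - \<eta>[X,Z]\<close>, \<open>(i\<^sub>Y d\<xi>)(Z) = - \<xi>[Y,Z]\<close>, \<open>(i\<^sub>X i\<^sub>Y H)(Z) = H(Y,X,Z)\<close>.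
\<close>

fun dorfman :: "('g::euclidean_space \<Rightarrow> 'g \<Rightarrow> 'g) \<Rightarrow> ('g \<Rightarrow> 'g \<Rightarrow> 'g \<Rightarrow> real) \<Rightarrow>
    ('g \<Rightarrow> 'g \<Rightarrow> real) \<Rightarrow> 'g gen \<Rightarrow> 'g gen \<Rightarrow> 'g gen" where
  "dorfman br H F (X, \<xi>, l) (Y, \<eta>, m) =
     (br X Y,
      Blinfun (\<lambda>Z. - blinfun_apply \<eta> (br X Z) + blinfun_apply \<xi> (br Y Z) + H Y X Z
                   - 2 * (m * F X Z - l * F Y Z)),
      F X Y)"

definition flat :: "('g::euclidean_space \<Rightarrow> 'g \<Rightarrow> real) \<Rightarrow> 'g \<Rightarrow> 'g \<Rightarrow>\<^sub>L real" where
  "flat g X = Blinfun (g X)"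

definition E_minus :: "('g::euclidean_space \<Rightarrow> 'g \<Rightarrow> real) \<Rightarrow> 'g gen set" where
  "E_minus g = {(X, - flat g X, 0) | X. True}"

definition gen_orth :: "'g::euclidean_space gen set \<Rightarrow> 'g gen set" where
  "gen_orth S = {u. \<forall>w\<in>S. gen_scalar u w = 0}"

definition induced_basis ::
  "('g::euclidean_space \<Rightarrow> 'g \<Rightarrow> real) \<Rightarrow> (nat \<Rightarrow> 'g) \<Rightarrow> nat \<Rightarrow> 'g gen" where
  "induced_basis g v A =
     (if A = 0 then (0, 0, 1)
      else if A \<le> 3 then (v A, flat g (v A), 0)
      else (v (A - 3), - flat g (v (A - 3)), 0))"


section \<open>Generalized connections and the generalized Einstein condition\<close>

definition gen_connection :: "('g::euclidean_space gen \<Rightarrow> 'g gen \<Rightarrow> 'g gen) \<Rightarrow> bool" where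
  "gen_connection D \<longleftrightarrow> bilinear D \<and>
     (\<forall>u v w. gen_scalar (D u v) w + gen_scalar v (D u w) = 0)"

definition gen_torsion :: "('g::euclidean_space gen \<Rightarrow> 'g gen \<Rightarrow> 'g gen) \<Rightarrow>
    ('g gen \<Rightarrow> 'g gen \<Rightarrow> 'g gen) \<Rightarrow> 'g gen \<Rightarrow> 'g gen \<Rightarrow> 'g gen \<Rightarrow> real" where
  "gen_torsion brE D u v w = gen_scalar (D u v - D v u - brE u v) w + gen_scalar v (D w u)"

definition gen_curvature :: "('g::euclidean_space gen \<Rightarrow> 'g gen \<Rightarrow> 'g gen) \<Rightarrow>
    ('g gen \<Rightarrow> 'g gen \<Rightarrow> 'g gen) \<Rightarrow> 'g gen \<Rightarrow> 'g gen \<Rightarrow> 'g gen \<Rightarrow> 'g gen" where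
  "gen_curvature brE D u v w = D u (D v w) - D v (D u w) - D (brE u v) w"

text \<open>The divergence of \<open>D\<close> at \<open>u\<close> is the trace of \<open>D u\<close> as the endomorphism \<open>w \<mapsto> D\<^sub>w u\<close>.\<close>

definition adapted_connection :: "('g::euclidean_space gen \<Rightarrow> 'g gen \<Rightarrow> 'g gen) \<Rightarrow>
    'g gen set \<Rightarrow> ('g gen \<Rightarrow> real) \<Rightarrow> ('g gen \<Rightarrow> 'g gen \<Rightarrow> 'g gen) \<Rightarrow> bool" where
  "adapted_connection brE Em \<delta> D \<longleftrightarrow>
     gen_connection D \<and>
     (\<forall>u. \<forall>v\<in>Em. D u v \<in> Em) \<and>
     (\<forall>u v w. gen_torsion brE D u v w = 0) \<and>
     (\<forall>u. trace_on UNIV (\<lambda>w. D w u) = \<delta> u)"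

definition generalized_einstein :: "('g::euclidean_space gen \<Rightarrow> 'g gen \<Rightarrow> 'g gen) \<Rightarrow>
    'g gen set \<Rightarrow> ('g gen \<Rightarrow> real) \<Rightarrow> bool" where
  "generalized_einstein brE Em \<delta> \<longleftrightarrow>
     (\<forall>D. adapted_connection brE Em \<delta> D \<longrightarrow>
        (\<forall>u\<in>Em. \<forall>v\<in>gen_orth Em. trace_on (gen_orth Em) (\<lambda>w. gen_curvature brE D w u v) = 0) \<and>
        (\<forall>u\<in>gen_orth Em. \<forall>v\<in>Em. trace_on Em (\<lambda>w. gen_curvature brE D w u v) = 0))"


section \<open>Case 7 and the two families\<close>

text \<open>
  Arguments: the signs \<open>\<epsilon>\<close>, the structure constants \<open>lam, \<mu>, \<nu>, \<rho>\<close>, the components \<open>h\<close> and \<open>Fc a b\<close>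
  of the forms in the basis \<open>v\<close>, and the components \<open>dc A\<close> of the divergence in the induced basis.
\<close>

definition vanishing_components :: "real \<Rightarrow> (nat \<Rightarrow> nat \<Rightarrow> real) \<Rightarrow> (nat \<Rightarrow> real) \<Rightarrow> bool" where
  "vanishing_components h Fc dc \<longleftrightarrow>
     Fc 1 3 = 0 \<and> h = 0 \<and> dc 0 = 0 \<and> dc 1 = 0 \<and> dc 3 = 0 \<and> dc 4 = 0 \<and> dc 6 = 0 \<and> dc 2 = dc 5"

definition case7_relations :: "(nat \<Rightarrow> real) \<Rightarrow> real \<Rightarrow> real \<Rightarrow> real \<Rightarrow> real \<Rightarrow>
    real \<Rightarrow> (nat \<Rightarrow> nat \<Rightarrow> real) \<Rightarrow> (nat \<Rightarrow> real) \<Rightarrow> bool" where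
  "case7_relations \<epsilon> lam \<mu> \<nu> \<rho> h Fc dc \<longleftrightarrow>
     \<mu> \<noteq> 0 \<and> \<nu> \<noteq> 0 \<and> Fc 1 2 \<noteq> 0 \<and> Fc 2 3 \<noteq> 0 \<and> \<epsilon> 1 * lam + \<epsilon> 3 * \<rho> \<noteq> 0 \<and>
     vanishing_components h Fc dc \<and>
     Fc 1 2 * \<epsilon> 3 * (dc 2 + \<epsilon> 1 * lam) = Fc 2 3 * \<nu> \<and>
     Fc 1 2 * \<mu> = Fc 2 3 * \<epsilon> 1 * (\<epsilon> 3 * \<rho> + dc 2) \<and>
     (Fc 1 2)\<^sup>2 = \<epsilon> 3 / 2 * (\<nu>\<^sup>2 - \<mu>\<^sup>2) + dc 2 * lam \<and>
     (Fc 2 3)\<^sup>2 = \<epsilon> 1 / 2 * (\<mu>\<^sup>2 - \<nu>\<^sup>2) + dc 2 * \<rho> \<and>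
     dc 2 * (\<epsilon> 1 * lam + \<epsilon> 3 * \<rho>) = - lam\<^sup>2 - \<epsilon> 1 * \<epsilon> 3 / 2 * (\<mu> + \<nu>)\<^sup>2 - \<rho>\<^sup>2 \<and>
     Fc 1 2 * Fc 2 3 =
       \<epsilon> 1 / 2 * lam * (\<nu> - \<mu>) + \<epsilon> 3 / 2 * \<rho> * (\<mu> - \<nu>) - dc 2 / 2 * (\<mu> + \<nu>)"

text \<open>\<open>lt\<close> and \<open>rt\<close> stand for \<open>\<delta>\<^sub>2 + \<epsilon>\<^sub>1 \<lambda>\<close> and \<open>\<delta>\<^sub>2 + \<epsilon>\<^sub>3 \<rho>\<close>.\<close>

definition common_relations :: "(nat \<Rightarrow> real) \<Rightarrow> real \<Rightarrow> real \<Rightarrow> real \<Rightarrow> real \<Rightarrow>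
    (nat \<Rightarrow> nat \<Rightarrow> real) \<Rightarrow> bool" where
  "common_relations \<epsilon> lt \<mu> \<nu> rt Fc \<longleftrightarrow>
     Fc 2 3 = Fc 1 2 * \<epsilon> 3 * (lt / \<nu>) \<and> rt = \<epsilon> 1 * \<epsilon> 3 * (\<mu> * \<nu> / lt)"

definition condition_i :: "(nat \<Rightarrow> real) \<Rightarrow> real \<Rightarrow> real \<Rightarrow> real \<Rightarrow>
    (nat \<Rightarrow> nat \<Rightarrow> real) \<Rightarrow> (nat \<Rightarrow> real) \<Rightarrow> bool" where
  "condition_i \<epsilon> lt \<mu> \<nu> Fc dc \<longleftrightarrow>
     \<mu> = \<nu> \<and> \<mu> * lt \<noteq> 0 \<and>
     dc 2 = lt + \<epsilon> 1 * \<epsilon> 3 * (\<mu>\<^sup>2 / lt) \<and>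
     (Fc 1 2)\<^sup>2 = - (\<mu> / lt)\<^sup>2 * (\<epsilon> 3 * lt\<^sup>2 + \<epsilon> 1 * \<mu>\<^sup>2) \<and>
     - (\<mu> / lt)\<^sup>2 * (\<epsilon> 3 * lt\<^sup>2 + \<epsilon> 1 * \<mu>\<^sup>2) > 0"

definition condition_ii :: "(nat \<Rightarrow> real) \<Rightarrow> real \<Rightarrow> real \<Rightarrow> real \<Rightarrow>
    (nat \<Rightarrow> nat \<Rightarrow> real) \<Rightarrow> (nat \<Rightarrow> real) \<Rightarrow> bool" where
  "condition_ii \<epsilon> lt \<mu> \<nu> Fc dc \<longleftrightarrow>
     lt\<^sup>2 \<noteq> \<nu>\<^sup>2 \<and> \<mu> * lt \<noteq> 0 \<and> \<epsilon> 3 = - \<epsilon> 1 \<and>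
     (\<exists>s\<in>{1, -1}.
        dc 2 = s / 2 * (\<nu> - \<mu>) \<and>
        lt\<^sup>2 + s / 2 * (\<nu> - \<mu>) * lt - \<mu> * \<nu> = 0 \<and>
        (Fc 1 2)\<^sup>2 = \<epsilon> 1 * (\<nu> - \<mu>) * \<nu> * (s * (\<mu> / (2 * lt)) - 1) \<and>
        \<epsilon> 1 * (\<nu> - \<mu>) * \<nu> * (s * (\<mu> / (2 * lt)) - 1) > 0)"

end

theory Submission
  imports Defs
begin

text \<open>
  The statement has three ingredients, and each becomes elementary once the right formula is found.

  The Einstein condition does not see the choice of connection. Let \<open>V\<close> and \<open>W\<close> be complementary
  orthogonal subbundles preserved by a torsion-free metric generalized connection \<open>D\<close> with divergence
  \<open>\<delta>\<close>. For \<open>u \<in> W\<close> and \<open>v \<in> V\<close> the torsion identity forces \<open>D\<^sub>u v\<close> to be the \<open>V\<close>-part of \<open>[u,v]\<close>. In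
  the trace of \<open>w \<mapsto> R(w,u)v\<close> over \<open>V\<close> the first term is \<open>\<delta>(D\<^sub>u v)\<close>, and the undetermined
  derivatives of \<open>V\<close> along \<open>V\<close> occur only as \<open>tr(D\<^sub>u \<circ> Dv) - tr(Dv \<circ> D\<^sub>u)\<close>. What is left is
  expressed by brackets and \<open>\<delta>\<close> alone; this is \<open>mixed_ricci_eq_trace\<close>. Hence the Einstein
  condition follows from finitely many equations on an orthogonal frame
  (\<open>generalized_einstein_if_mixed_ricci_zero\<close>), and in the induced basis these equations are
  linear consequences of the case 7 relations (\<open>case7_generalized_einstein\<close>).

  The case 7 relations can be solved explicitly. Put \<open>a = \<delta>\<^sub>2 + \<epsilon>\<^sub>1\<lambda>\<close>, \<open>r = \<delta>\<^sub>2 + \<epsilon>\<^sub>3\<rho>\<close>, \<open>d = \<delta>\<^sub>2\<close>.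
  The first two relations give \<open>F\<^sub>2\<^sub>3\<close> and \<open>ar = \<epsilon>\<^sub>1\<epsilon>\<^sub>3\<mu>\<nu>\<close>. After eliminating \<open>F\<^sub>1\<^sub>2\<close>, the remaining ones reduce to
  \<open>2(a+r)(a+r-d) + \<epsilon>\<^sub>1\<epsilon>\<^sub>3(\<nu>-\<mu>)\<^sup>2 = 0\<close> and \<open>(\<nu>-\<mu>)(d+a+r)(\<nu>r+a\<mu>) = 0\<close>. The factor \<open>\<nu>-\<mu>\<close> gives family
  i, the factor \<open>d+a+r\<close> gives family ii, and the factor \<open>\<nu>r+a\<mu>\<close> would make \<open>\<epsilon>\<^sub>1\<lambda> + \<epsilon>\<^sub>3\<rho> = a+r-2d\<close>
  vanish, contrary to the Lie algebra not being unimodular. The two directions are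
  \<open>family_conditions_if_case7\<close> and \<open>case7_if_family_conditions\<close>.

  The Lie algebra is read off from eigenvalues. The endomorphism \<open>ad v\<^sub>2\<close> of the plane spanned by
  \<open>v\<^sub>1, v\<^sub>3\<close> has trace \<open>a+r-2d\<close> and determinant \<open>d(d-a-r)\<close>. In family i, where \<open>d = a+r\<close>, the
  eigenvalues are \<open>-d\<close> and \<open>0\<close>; in family ii, where \<open>d = -(a+r)\<close>, they are \<open>-2d\<close> and \<open>-d\<close>. In both
  cases they are distinct, and rescaling \<open>v\<^sub>2\<close> gives \<open>diag(1,0)\<close> and \<open>diag(1,1/2)\<close>
  (\<open>lie_isomorphic_semidirect_diag\<close>).
\<close>

section \<open>Traces in orthogonal frames\<close>

locale orthogonal_frame =
  fixes G :: "'a::real_vector \<Rightarrow> 'a \<Rightarrow> real" and e :: "'i \<Rightarrow> 'a" and I :: "'i set"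
  assumes bil: "bilinear G"
    and fin: "finite I"
    and orth: "\<And>i j. i \<in> I \<Longrightarrow> j \<in> I \<Longrightarrow> i \<noteq> j \<Longrightarrow> G (e i) (e j) = 0"
    and nonnull: "\<And>i. i \<in> I \<Longrightarrow> G (e i) (e i) \<noteq> 0"
begin

lemma linear_left: "linear (\<lambda>x. G x y)" and linear_right: "linear (G x)"
  using bil by (auto simp: bilinear_def)

lemma expand:
  assumes "x \<in> span (e ` I)"
  shows "x = (\<Sum>i\<in>I. (G x (e i) / G (e i) (e i)) *\<^sub>R e i)"
proof -
  have "linear (\<lambda>x. \<Sum>i\<in>I. (G x (e i) / G (e i) (e i)) *\<^sub>R e i)"
    by (rule linearI)
      (simp_all add: linear_add[OF linear_left] linear_cmul[OF linear_left] add_divide_distrib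
        scaleR_left_distrib sum.distrib scaleR_sum_right)
  moreover have "e j = (\<Sum>i\<in>I. (G (e j) (e i) / G (e i) (e i)) *\<^sub>R e i)" if "j \<in> I" for j
  proof -
    have "(\<Sum>i\<in>I. (G (e j) (e i) / G (e i) (e i)) *\<^sub>R e i) = (\<Sum>i\<in>I. if i = j then e i else 0)"
      using that orth nonnull by (intro sum.cong) auto
    then show ?thesis using that fin by simp
  qed
  ultimately show ?thesis
    using linear_eq_on_span[OF linear_id, of _ "e ` I" x] assms by (auto simp: id_def)
qed

lemma expand_inner:
  assumes "x \<in> span (e ` I)"
  shows "G x y = (\<Sum>i\<in>I. G x (e i) * G (e i) y / G (e i) (e i))"
  by (subst expand[OF assms])
    (simp add: linear_sum[OF linear_left] linear_cmul[OF linear_left])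

lemma orthogonal_span:
  assumes "\<And>i. i \<in> I \<Longrightarrow> G x (e i) = 0" "y \<in> span (e ` I)"
  shows "G x y = 0"
  using linear_eq_0_on_span[OF linear_right _ assms(2)] assms(1) by auto

text \<open>
  Evaluating \<open>trace_on\<close> in the unspecified basis \<open>B\<close> of its definition and expanding \<open>f b\<close> in the frame,
  the coefficients of \<open>B\<close> recombine to the frame vectors, so the trace is the usual contraction.
\<close>

lemma trace_on_span:
  assumes f: "linear f" "f ` span (e ` I) \<subseteq> span (e ` I)"
  shows "trace_on (span (e ` I)) f = (\<Sum>i\<in>I. G (f (e i)) (e i) / G (e i) (e i))"
proof -
  let ?S = "span (e ` I)"
  define B where "B = (SOME B. independent B \<and> span B = ?S)"
  have "\<exists>B. independent B \<and> span B = ?S"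
    by (metis basis_exists span_span span_mono subset_antisym)
  then have B: "independent B" "span B = ?S"
    unfolding B_def by (metis (mono_tags, lifting) someI_ex)+
  have finB: "finite B"
    using independent_span_bound[of "e ` I" B] fin B span_superset[of B] by auto
  have fb: "f b \<in> ?S" if "b \<in> B" for b
    using that f(2) B(2) span_base[of b B] by auto
  have lin_rep: "representation B (\<Sum>i\<in>I. c i *\<^sub>R e i) b = (\<Sum>i\<in>I. c i * representation B (e i) b)"
    for c b
    using B by (subst representation_sum)
      (auto intro!: sum.cong simp: representation_scale span_base span_scale)
  have "trace_on ?S f = (\<Sum>b\<in>B. representation B (f b) b)"
    unfolding trace_on_def Let_def B_def[symmetric] ..
  also have "\<dots> = (\<Sum>b\<in>B. \<Sum>i\<in>I. G (f b) (e i) / G (e i) (e i) * representation B (e i) b)"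
    by (intro sum.cong refl) (subst expand[OF fb], simp_all only: lin_rep)
  also have "\<dots> = (\<Sum>i\<in>I. (\<Sum>b\<in>B. representation B (e i) b * G (f b) (e i)) / G (e i) (e i))"
    by (subst sum.swap) (simp add: sum_divide_distrib mult.commute)
  also have "\<dots> = (\<Sum>i\<in>I. G (f (e i)) (e i) / G (e i) (e i))"
  proof (intro sum.cong refl)
    fix i assume "i \<in> I"
    then have "e i = (\<Sum>b\<in>B. representation B (e i) b *\<^sub>R b)"
      using sum_representation_eq[OF B(1), of "e i" B] B(2) finB by (simp add: span_base)
    then have "G (f (e i)) (e i) = G (f (\<Sum>b\<in>B. representation B (e i) b *\<^sub>R b)) (e i)"
      by simp
    also have "\<dots> = (\<Sum>b\<in>B. representation B (e i) b * G (f b) (e i))"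
      by (simp add: linear_sum[OF f(1)] linear_cmul[OF f(1)]
          linear_sum[OF linear_left] linear_cmul[OF linear_left])
    finally show "(\<Sum>b\<in>B. representation B (e i) b * G (f b) (e i)) / G (e i) (e i) =
        G (f (e i)) (e i) / G (e i) (e i)" by simp
  qed
  finally show ?thesis .
qed

end

section \<open>Mixed Ricci curvature of an orthogonal splitting\<close>

lemma bilinear_gen_scalar: "bilinear gen_scalar"
  unfolding bilinear_def
proof (intro conjI allI linearI; clarify)
qed (auto simp: blinfun.add_left blinfun.add_right blinfun.scaleR_left blinfun.scaleR_right algebra_simps)

lemma gen_scalar_commute: "gen_scalar u w = gen_scalar w u"
  by (cases u; cases w) (simp add: algebra_simps)

text \<open>Sections are manipulated as vectors from here on; their three components matter again only for brackets.\<close>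

declare gen_scalar.simps [simp del]

lemma gen_curvature_linear:
  assumes "bilinear D" "bilinear brE"
  shows "linear (\<lambda>w. gen_curvature brE D w u v)"
  using assms unfolding gen_curvature_def
  by (intro linearI) (simp_all add: bilinear_ladd bilinear_radd bilinear_lmul bilinear_rmul algebra_simps)

text \<open>
  For \<open>V\<close> and \<open>W\<close> with orthogonal frames indexed by \<open>P\<close> and \<open>M\<close>, this is
  \<open>\<delta>([u,v]\<^sub>V) - tr\<^sub>V (w \<mapsto> [[w,u]\<^sub>W, v]\<^sub>V)\<close>: the Ricci curvature of a pair \<open>u \<in> W\<close>, \<open>v \<in> V\<close>, written
  without reference to a connection.
\<close>

definition mixed_ricci :: "('i \<Rightarrow> 'g::euclidean_space gen) \<Rightarrow> 'i set \<Rightarrow> 'i set \<Rightarrow>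
    ('g gen \<Rightarrow> 'g gen \<Rightarrow> 'g gen) \<Rightarrow> ('g gen \<Rightarrow> real) \<Rightarrow> 'g gen \<Rightarrow> 'g gen \<Rightarrow> real" where
  "mixed_ricci e P M brE \<delta> u v =
     (\<Sum>k\<in>P. gen_scalar (brE u v) (e k) * \<delta> (e k) / gen_scalar (e k) (e k)) -
     (\<Sum>i\<in>P. \<Sum>j\<in>M. gen_scalar (brE (e i) u) (e j) * gen_scalar (brE (e j) v) (e i) /
        (gen_scalar (e i) (e i) * gen_scalar (e j) (e j)))"

lemma linear_mixed_ricci:
  assumes brE: "bilinear brE"
  shows "linear (\<lambda>u. mixed_ricci e P M brE \<delta> u v)" "linear (mixed_ricci e P M brE \<delta> u)"
  by (rule linearI; simp add: mixed_ricci_def bilinear_ladd[OF brE] bilinear_radd[OF brE]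
      bilinear_lmul[OF brE] bilinear_rmul[OF brE]
      bilinear_ladd[OF bilinear_gen_scalar] bilinear_lmul[OF bilinear_gen_scalar]
      distrib_left distrib_right add_divide_distrib sum.distrib sum_distrib_left
      right_diff_distrib mult.assoc mult.left_commute)+

locale split_frame = V: orthogonal_frame gen_scalar e P + W: orthogonal_frame gen_scalar e M
  for e :: "'i \<Rightarrow> 'g::euclidean_space gen" and P M :: "'i set" +
  assumes VW: "i \<in> P \<Longrightarrow> j \<in> M \<Longrightarrow> gen_scalar (e i) (e j) = 0"
    and spanning: "span (e ` (P \<union> M)) = UNIV"
    and disj: "P \<inter> M = {}"

begin

lemma WV: "i \<in> P \<Longrightarrow> j \<in> M \<Longrightarrow> gen_scalar (e j) (e i) = 0"
  using VW by (subst gen_scalar_commute)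

lemma swap: "split_frame e M P"
  using spanning disj
  by (intro split_frame.intro split_frame_axioms.intro V.orthogonal_frame_axioms
      W.orthogonal_frame_axioms) (auto simp: Un_commute WV)

sublocale U: orthogonal_frame gen_scalar e "P \<union> M"
proof (unfold_locales, goal_cases)
  case 1 show ?case by (rule V.bil)
next
  case 2 show ?case using V.fin W.fin by simp
next
  case (3 i j) then show ?case using V.orth[of i j] W.orth[of i j] VW[of i j] WV[of j i] by blast
next
  case (4 i) then show ?case using V.nonnull W.nonnull by blast
qed

lemma orthogonal_spans:
  assumes "x \<in> span (e ` P)" "y \<in> span (e ` M)"
  shows "gen_scalar x y = 0" "gen_scalar y x = 0"
proof -
  have "gen_scalar x (e j) = 0" if "j \<in> M" for j
    using V.orthogonal_span[of "e j" x] that VW assms(1) by (simp add: gen_scalar_commute)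
  then show "gen_scalar x y = 0" using W.orthogonal_span assms(2) by blast
  then show "gen_scalar y x = 0" by (simp add: gen_scalar_commute)
qed

text \<open>The frame of \<open>V\<close> spans the whole orthogonal complement of \<open>W\<close>, since the joint frame spans the space.\<close>

lemma gen_orth_span: "gen_orth (span (e ` M)) = span (e ` P)"
proof
  show "gen_orth (span (e ` M)) \<subseteq> span (e ` P)"
  proof
    fix x assume x: "x \<in> gen_orth (span (e ` M))"
    have 0: "gen_scalar x (e j) = 0" if "j \<in> M" for j
      using x that span_base[of "e j" "e ` M"] by (auto simp: gen_orth_def)
    have "x = (\<Sum>i\<in>P \<union> M. (gen_scalar x (e i) / gen_scalar (e i) (e i)) *\<^sub>R e i)"
      using U.expand spanning by blast
    also have "\<dots> = (\<Sum>i\<in>P. (gen_scalar x (e i) / gen_scalar (e i) (e i)) *\<^sub>R e i)"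
      using 0 V.fin W.fin by (intro sum.mono_neutral_right) auto
    also have "\<dots> \<in> span (e ` P)"
      by (intro span_sum span_scale span_base) auto
    finally show "x \<in> span (e ` P)" .
  qed
  show "span (e ` P) \<subseteq> gen_orth (span (e ` M))"
    unfolding gen_orth_def using orthogonal_spans(1) by blast
qed

text \<open>
  The curvature trace splits into three terms. The first is the divergence of \<open>D\<^sub>u v\<close>, because \<open>D\<close>
  preserves \<open>V\<close> and therefore \<open>w \<mapsto> D\<^sub>w x\<close>, for \<open>x \<in> V\<close>, has no trace over \<open>W\<close>. In the
  other two, the derivatives of \<open>v\<close> along \<open>V\<close>, which torsion and divergence do not determine, enter
  only through \<open>tr(D\<^sub>u \<circ> Dv)\<close> and cancel.
\<close>

lemma mixed_ricci_eq_trace: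
  assumes D: "gen_connection D" and bE: "bilinear brE"
    and presV: "\<And>x y. y \<in> span (e ` P) \<Longrightarrow> D x y \<in> span (e ` P)"
    and presW: "\<And>x y. y \<in> span (e ` M) \<Longrightarrow> D x y \<in> span (e ` M)"
    and tor: "\<And>x y z. gen_torsion brE D x y z = 0"
    and div: "\<And>x. trace_on UNIV (\<lambda>w. D w x) = \<delta> x"
    and u: "u \<in> span (e ` M)" and v: "v \<in> span (e ` P)"
    and lin: "linear \<delta>"
  shows "trace_on (span (e ` P)) (\<lambda>w. gen_curvature brE D w u v) = mixed_ricci e P M brE \<delta> u v"
proof -
  let ?G = gen_scalar
  let ?\<eta> = "\<lambda>i. ?G (e i) (e i)"
  have bD: "bilinear D" using D unfolding gen_connection_def by (rule conjunct1)
  have metric: "?G (D x y) z = - ?G y (D x z)" for x y z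
    unfolding eq_neg_iff_add_eq_0 using D[unfolded gen_connection_def, THEN conjunct2] by blast
  have eP: "e i \<in> span (e ` P)" if "i \<in> P" for i using that by (auto intro: span_base)
  have eM: "e i \<in> span (e ` M)" if "i \<in> M" for i using that by (auto intro: span_base)
  note blin = bilinear_lsub[OF V.bil] bilinear_ladd[OF V.bil]
  \<comment> \<open>Both identities are the torsion equation with every term dropped that pairs \<open>V\<close> with \<open>W\<close>.\<close>
  have mixedV: "?G (D x y) z = ?G (brE x y) z"
    if "x \<in> span (e ` M)" "y \<in> span (e ` P)" "z \<in> span (e ` P)" for x y z
    using tor[of x y z] that orthogonal_spans presV presW unfolding gen_torsion_def by (simp add: blin)
  have skewV: "?G (brE y x) z = - ?G (D x y) z"
    if "x \<in> span (e ` M)" "y \<in> span (e ` P)" "z \<in> span (e ` P)" for x y z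
    using tor[of y x z] that orthogonal_spans presV presW unfolding gen_torsion_def by (simp add: blin)
  have T1: "(\<Sum>i\<in>P. ?G (D (e i) (D u v)) (e i) / ?\<eta> i) =
      (\<Sum>k\<in>P. ?G (brE u v) (e k) * \<delta> (e k) / ?\<eta> k)"
  proof -
    have Duv: "D u v \<in> span (e ` P)" using presV v by blast
    have "(\<Sum>k\<in>P. ?G (brE u v) (e k) * \<delta> (e k) / ?\<eta> k) = (\<Sum>k\<in>P. ?G (D u v) (e k) * \<delta> (e k) / ?\<eta> k)"
      using mixedV u v eP by (intro sum.cong) auto
    also have "\<dots> = \<delta> (\<Sum>k\<in>P. (?G (D u v) (e k) / ?\<eta> k) *\<^sub>R e k)"
      by (simp add: linear_sum[OF lin] linear_cmul[OF lin])
    also have "\<dots> = \<delta> (D u v)" using V.expand[OF Duv] by simp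
    also have "\<dots> = trace_on (span (e ` (P \<union> M))) (\<lambda>w. D w (D u v))"
      using div spanning by simp
    also have "\<dots> = (\<Sum>i\<in>P \<union> M. ?G (D (e i) (D u v)) (e i) / ?\<eta> i)"
      using bD[unfolded bilinear_def] spanning
      by (intro U.trace_on_span) (auto simp del: split_paired_All)
    also have "\<dots> = (\<Sum>i\<in>P. ?G (D (e i) (D u v)) (e i) / ?\<eta> i)"
    proof (intro sum.mono_neutral_right ballI)
      fix i assume "i \<in> P \<union> M - P"
      then have i: "i \<in> M" by blast
      show "?G (D (e i) (D u v)) (e i) / ?\<eta> i = 0"
        by (simp only: orthogonal_spans(1)[OF presV[OF Duv] eM[OF i]] div_0)
    qed (use V.fin W.fin in auto)
    finally show ?thesis by simp
  qed
  have T2: "(\<Sum>i\<in>P. ?G (D u (D (e i) v)) (e i) / ?\<eta> i) =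
      - (\<Sum>i\<in>P. \<Sum>k\<in>P. ?G (D (e i) v) (e k) * ?G (D u (e i)) (e k) / (?\<eta> i * ?\<eta> k))"
    unfolding sum_negf[symmetric]
  proof (intro sum.cong refl)
    fix i assume i: "i \<in> P"
    have "?G (D u (D (e i) v)) (e i) = - ?G (D (e i) v) (D u (e i))" by (rule metric)
    also have "\<dots> = - (\<Sum>k\<in>P. ?G (D (e i) v) (e k) * ?G (e k) (D u (e i)) / ?\<eta> k)"
      using V.expand_inner[OF presV[OF v], of "e i" "D u (e i)"] by (rule arg_cong)
    finally show "?G (D u (D (e i) v)) (e i) / ?\<eta> i =
        (\<Sum>k\<in>P. - (?G (D (e i) v) (e k) * ?G (D u (e i)) (e k) / (?\<eta> i * ?\<eta> k)))"
      by (simp add: sum_divide_distrib sum_negf gen_scalar_commute[of "e _" "D _ _"] mult.commute)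
  qed
  have T3: "(\<Sum>i\<in>P. ?G (D (brE (e i) u) v) (e i) / ?\<eta> i) =
      - (\<Sum>i\<in>P. \<Sum>k\<in>P. ?G (D u (e i)) (e k) * ?G (D (e k) v) (e i) / (?\<eta> i * ?\<eta> k)) +
      (\<Sum>i\<in>P. \<Sum>j\<in>M. ?G (brE (e i) u) (e j) * ?G (brE (e j) v) (e i) / (?\<eta> i * ?\<eta> j))"
    unfolding sum_negf[symmetric] sum.distrib[symmetric]
  proof (intro sum.cong refl)
    fix i assume i: "i \<in> P"
    let ?b = "brE (e i) u"
    have "linear (\<lambda>w. D w v)" using bD unfolding bilinear_def by blast
    from linear_compose[OF this V.linear_left[of "e i"]]
    have "linear (\<lambda>w. ?G (D w v) (e i))" by (simp only: o_def)
    note l = linear_sum[OF this] linear_cmul[OF this]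
    have "?b = (\<Sum>k\<in>P \<union> M. (?G ?b (e k) / ?\<eta> k) *\<^sub>R e k)"
      using U.expand spanning by blast
    from arg_cong[OF this, of "\<lambda>w. ?G (D w v) (e i)"]
    have "?G (D ?b v) (e i) = (\<Sum>k\<in>P \<union> M. ?G ?b (e k) / ?\<eta> k * ?G (D (e k) v) (e i))"
      by (simp only: l real_scaleR_def)
    also have "\<dots> = (\<Sum>k\<in>P. ?G ?b (e k) / ?\<eta> k * ?G (D (e k) v) (e i)) +
        (\<Sum>k\<in>M. ?G ?b (e k) / ?\<eta> k * ?G (D (e k) v) (e i))"
      using V.fin W.fin disj by (intro sum.union_disjoint) auto
    also have "(\<Sum>k\<in>P. ?G ?b (e k) / ?\<eta> k * ?G (D (e k) v) (e i)) =
        (\<Sum>k\<in>P. - (?G (D u (e i)) (e k) * ?G (D (e k) v) (e i) / ?\<eta> k))"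
      using skewV[OF u] i eP by (intro sum.cong) auto
    also have "(\<Sum>k\<in>M. ?G ?b (e k) / ?\<eta> k * ?G (D (e k) v) (e i)) =
        (\<Sum>k\<in>M. ?G ?b (e k) * ?G (brE (e k) v) (e i) / ?\<eta> k)"
      using mixedV[OF _ v] i eP eM by (intro sum.cong) auto
    finally show "?G (D ?b v) (e i) / ?\<eta> i =
       (\<Sum>k\<in>P. - (?G (D u (e i)) (e k) * ?G (D (e k) v) (e i) / (?\<eta> i * ?\<eta> k))) +
       (\<Sum>j\<in>M. ?G ?b (e j) * ?G (brE (e j) v) (e i) / (?\<eta> i * ?\<eta> j))"
      by (simp add: add_divide_distrib sum_divide_distrib mult.commute)
  qed
  \<comment> \<open>The metric property makes \<open>D\<^sub>u\<close> skew on \<open>V\<close>, so exchanging the summation indices changes the sign.\<close>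
  have cancel: "(\<Sum>i\<in>P. \<Sum>k\<in>P. ?G (D u (e i)) (e k) * ?G (D (e k) v) (e i) / (?\<eta> i * ?\<eta> k)) =
      - (\<Sum>i\<in>P. \<Sum>k\<in>P. ?G (D (e i) v) (e k) * ?G (D u (e i)) (e k) / (?\<eta> i * ?\<eta> k))"
    unfolding sum_negf[symmetric]
    by (subst sum.swap, intro sum.cong refl, subst metric)
      (simp add: gen_scalar_commute mult.commute)
  have "trace_on (span (e ` P)) (\<lambda>w. gen_curvature brE D w u v) =
      (\<Sum>i\<in>P. ?G (gen_curvature brE D (e i) u v) (e i) / ?\<eta> i)"
  proof (intro V.trace_on_span gen_curvature_linear[OF bD bE])
    show "(\<lambda>w. gen_curvature brE D w u v) ` span (e ` P) \<subseteq> span (e ` P)"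
      unfolding gen_curvature_def by (intro image_subsetI span_diff presV v)
  qed
  also have "\<dots> = (\<Sum>i\<in>P. ?G (D (e i) (D u v)) (e i) / ?\<eta> i)
      - (\<Sum>i\<in>P. ?G (D u (D (e i) v)) (e i) / ?\<eta> i) - (\<Sum>i\<in>P. ?G (D (brE (e i) u) v) (e i) / ?\<eta> i)"
    by (simp add: gen_curvature_def blin diff_divide_distrib sum_subtractf)
  also have "\<dots> = mixed_ricci e P M brE \<delta> u v"
    unfolding T1 T2 T3 cancel mixed_ricci_def by simp
  finally show ?thesis .
qed

text \<open>
  The frame formula is bilinear in \<open>u\<close> and \<open>v\<close>, so it is enough to test frame vectors; exchanging the
  roles of \<open>V\<close> and \<open>W\<close> gives the second half of the Einstein condition.
\<close>

theorem generalized_einstein_if_mixed_ricci_zero: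
  assumes bE: "bilinear brE" and lin: "linear \<delta>"
    and ricP: "\<And>i j. i \<in> P \<Longrightarrow> j \<in> M \<Longrightarrow> mixed_ricci e P M brE \<delta> (e j) (e i) = 0"
    and ricM: "\<And>i j. i \<in> P \<Longrightarrow> j \<in> M \<Longrightarrow> mixed_ricci e M P brE \<delta> (e i) (e j) = 0"
  shows "generalized_einstein brE (span (e ` M)) \<delta>"
proof -
  have zeroP: "mixed_ricci e P M brE \<delta> u v = 0" if "u \<in> span (e ` M)" "v \<in> span (e ` P)" for u v
  proof -
    have "mixed_ricci e P M brE \<delta> (e j) v = 0" if "j \<in> M" for j
      by (rule linear_eq_0_on_span[OF linear_mixed_ricci(2)[OF bE] _ \<open>v \<in> _\<close>]) (use that ricP in auto)
    then show ?thesis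
      using linear_eq_0_on_span[OF linear_mixed_ricci(1)[OF bE] _ \<open>u \<in> _\<close>] by blast
  qed
  have zeroM: "mixed_ricci e M P brE \<delta> u v = 0" if "u \<in> span (e ` P)" "v \<in> span (e ` M)" for u v
  proof -
    have "mixed_ricci e M P brE \<delta> (e j) v = 0" if "j \<in> P" for j
      by (rule linear_eq_0_on_span[OF linear_mixed_ricci(2)[OF bE] _ \<open>v \<in> _\<close>]) (use that ricM in auto)
    then show ?thesis
      using linear_eq_0_on_span[OF linear_mixed_ricci(1)[OF bE] _ \<open>u \<in> _\<close>] by blast
  qed
  show ?thesis
    unfolding generalized_einstein_def gen_orth_span
  proof (intro allI impI)
    fix D assume "adapted_connection brE (span (e ` M)) \<delta> D"
    then have con: "gen_connection D" and presM: "\<And>x y. y \<in> span (e ` M) \<Longrightarrow> D x y \<in> span (e ` M)"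
      and tor: "\<And>x y z. gen_torsion brE D x y z = 0"
      and div: "\<And>x. trace_on UNIV (\<lambda>w. D w x) = \<delta> x"
      unfolding adapted_connection_def by blast+
    have presP: "D x y \<in> span (e ` P)" if "y \<in> span (e ` P)" for x y
      unfolding gen_orth_span[symmetric] gen_orth_def
    proof (intro CollectI ballI)
      fix w assume "w \<in> span (e ` M)"
      then have "gen_scalar y (D x w) = 0"
        using presM orthogonal_spans(1) that by blast
      moreover have "gen_scalar (D x y) w + gen_scalar y (D x w) = 0"
        using con unfolding gen_connection_def by blast
      ultimately show "gen_scalar (D x y) w = 0" by linarith
    qed
    show "(\<forall>u\<in>span (e ` M). \<forall>v\<in>span (e ` P).
          trace_on (span (e ` P)) (\<lambda>w. gen_curvature brE D w u v) = 0) \<and>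
        (\<forall>u\<in>span (e ` P). \<forall>v\<in>span (e ` M).
          trace_on (span (e ` M)) (\<lambda>w. gen_curvature brE D w u v) = 0)"
      using mixed_ricci_eq_trace[OF con bE presP presM tor div _ _ lin]
        split_frame.mixed_ricci_eq_trace[OF swap con bE presM presP tor div _ _ lin] zeroP zeroM
      by (intro conjI ballI) simp_all
  qed
qed

end

section \<open>The induced basis\<close>

text \<open>Keeps the index \<open>1\<close> of basis vectors and forms in the shape in which it is written.\<close>

declare One_nat_def [simp del]

lemma bounded_linear_of_linear: "linear f \<Longrightarrow> bounded_linear f" for f :: "'a::euclidean_space \<Rightarrow> 'b::real_normed_vector"
  by (simp add: linear_conv_bounded_linear)

lemma blinfun_apply_flat:
  assumes "bilinear g"
  shows "blinfun_apply (flat g X) = g X"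
  using assms by (auto simp: flat_def bilinear_def intro!: bounded_linear_Blinfun_apply bounded_linear_of_linear)

lemma linear_flat: "bilinear g \<Longrightarrow> linear (flat g)"
  by (intro linearI blinfun_eqI)
    (simp_all add: blinfun_apply_flat bilinear_ladd bilinear_lmul blinfun.add_left blinfun.scaleR_left)

lemma alternating_swap:
  assumes "bilinear B" "\<And>x. B x x = 0"
  shows "B x y = - B y x"
proof -
  have "B (x + y) (x + y) = B x y + B y x"
    using assms(2)[of x] assms(2)[of y] by (simp add: bilinear_ladd[OF assms(1)] bilinear_radd[OF assms(1)])
  then show ?thesis using assms(2)[of "x + y"] by (simp add: eq_neg_iff_add_eq_0)
qed

locale invariant_frame =
  fixes br :: "'g::euclidean_space \<Rightarrow> 'g \<Rightarrow> 'g" and g F :: "'g \<Rightarrow> 'g \<Rightarrow> real"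
    and H :: "'g \<Rightarrow> 'g \<Rightarrow> 'g \<Rightarrow> real" and v :: "nat \<Rightarrow> 'g"
  assumes lie: "lie_algebra br" and metric: "pseudo_metric g" and onb: "orthonormal_basis g v"
    and two: "two_form F" and three: "three_form H"
begin

lemma bil_br: "bilinear br" and bil_g: "bilinear g" and bil_F: "bilinear F"
  and g_sym: "g x y = g y x" and br_self: "br x x = 0" and F_self: "F x x = 0"
  using lie metric two by (auto simp: lie_algebra_def pseudo_metric_def two_form_def)

lemmas br_simps = bilinear_ladd[OF bil_br] bilinear_radd[OF bil_br] bilinear_lmul[OF bil_br]
  bilinear_rmul[OF bil_br] bilinear_lneg[OF bil_br] bilinear_rneg[OF bil_br]
  bilinear_lzero[OF bil_br] bilinear_rzero[OF bil_br]
lemmas g_simps = bilinear_ladd[OF bil_g] bilinear_radd[OF bil_g] bilinear_lmul[OF bil_g]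
  bilinear_rmul[OF bil_g] bilinear_lneg[OF bil_g] bilinear_rneg[OF bil_g]
  bilinear_lsub[OF bil_g] bilinear_rsub[OF bil_g] bilinear_lzero[OF bil_g] bilinear_rzero[OF bil_g]
lemmas F_simps = bilinear_ladd[OF bil_F] bilinear_radd[OF bil_F] bilinear_lmul[OF bil_F]
  bilinear_rmul[OF bil_F] bilinear_lneg[OF bil_F] bilinear_rneg[OF bil_F]
  bilinear_lzero[OF bil_F] bilinear_rzero[OF bil_F]

lemma H_lin: "linear (\<lambda>x. H x y z)" "linear (\<lambda>y. H x y z)" "linear (\<lambda>z. H x y z)"
  using three by (auto simp: three_form_def)

lemmas H_simps = linear_add[OF H_lin(1)] linear_add[OF H_lin(2)] linear_add[OF H_lin(3)]
  linear_cmul[OF H_lin(1)] linear_cmul[OF H_lin(2)] linear_cmul[OF H_lin(3)]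
  linear_0[OF H_lin(1)] linear_0[OF H_lin(2)] linear_0[OF H_lin(3)]

lemma br_swap: "br x y = - br y x" and F_swap: "F x y = - F y x"
  by (rule alternating_swap[OF bil_br br_self], rule alternating_swap[OF bil_F F_self])

lemma H_alt: "H x x z = 0" "H x z x = 0" "H z x x = 0"
  using three by (auto simp: three_form_def)

lemma H_swap: "H x y z = - H y x z" "H x y z = - H x z y"
proof -
  have "bilinear (\<lambda>x y. H x y z)" "bilinear (\<lambda>y z. H x y z)"
    using H_lin by (auto simp: bilinear_def)
  from alternating_swap[OF this(1)] alternating_swap[OF this(2)]
  show "H x y z = - H y x z" "H x y z = - H x z y" using H_alt by blast+
qed

lemma H_basis_zero:
  assumes "H (v 1) (v 2) (v 3) = 0" "a \<in> {1,2,3}" "b \<in> {1,2,3}" "c \<in> {1,2,3}"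
  shows "H (v a) (v b) (v c) = 0"
proof -
  have 1: "H (v 2) (v 1) (v 3) = 0" "H (v 1) (v 3) (v 2) = 0"
    using H_swap[of "v 1" "v 2" "v 3"] assms(1) by simp_all
  have 2: "H (v 2) (v 3) (v 1) = 0" "H (v 3) (v 1) (v 2) = 0"
    using H_swap(2)[of "v 2" "v 1" "v 3"] H_swap(1)[of "v 1" "v 3" "v 2"] 1 by simp_all
  have 3: "H (v 3) (v 2) (v 1) = 0"
    using H_swap(2)[of "v 3" "v 1" "v 2"] 2 by simp
  show ?thesis
    using assms(2-4) by (elim insertE emptyE) (simp_all add: assms(1) 1 2 3 H_alt)
qed

lemma v_inner: "g (v 1) (v 2) = 0" "g (v 2) (v 1) = 0" "g (v 1) (v 3) = 0"
    "g (v 3) (v 1) = 0" "g (v 2) (v 3) = 0" "g (v 3) (v 2) = 0"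
  and v_sign: "a \<in> {1,2,3} \<Longrightarrow> g (v a) (v a) = 1 \<or> g (v a) (v a) = -1"
  and v_span: "span (v ` {1,2,3}) = UNIV"
proof -
  have "{1..3} = {1,2,3::nat}" by auto
  then show "g (v 1) (v 2) = 0" "g (v 2) (v 1) = 0" "g (v 1) (v 3) = 0"
    "g (v 3) (v 1) = 0" "g (v 2) (v 3) = 0" "g (v 3) (v 2) = 0"
    "a \<in> {1,2,3} \<Longrightarrow> g (v a) (v a) = 1 \<or> g (v a) (v a) = -1" "span (v ` {1,2,3}) = UNIV"
    using onb by (auto simp: orthonormal_basis_def)
qed

sublocale vf: orthogonal_frame g v "{1,2,3}"
proof
  show "g (v i) (v j) = 0" if "i \<in> {1,2,3}" "j \<in> {1,2,3}" "i \<noteq> j" for i j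
    using that by (elim insertE emptyE) (simp_all add: v_inner)
  show "g (v i) (v i) \<noteq> 0" if "i \<in> {1,2,3}" for i
    using v_sign[OF that] by auto
qed (simp_all add: bil_g)

definition dorfman_covector :: "'g gen \<Rightarrow> 'g gen \<Rightarrow> 'g \<Rightarrow>\<^sub>L real" where
  "dorfman_covector x y = fst (snd (dorfman br H F x y))"

lemma dorfman_eq:
  "dorfman br H F (X, \<xi>, l) (Y, \<eta>, m) = (br X Y, dorfman_covector (X, \<xi>, l) (Y, \<eta>, m), F X Y)"
  by (simp add: dorfman_covector_def)

lemma dorfman_covector_apply:
  "blinfun_apply (dorfman_covector (X, \<xi>, l) (Y, \<eta>, m)) Z =
     - blinfun_apply \<eta> (br X Z) + blinfun_apply \<xi> (br Y Z) + H Y X Z - 2 * (m * F X Z - l * F Y Z)"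
  unfolding dorfman_covector_def dorfman.simps fst_conv snd_conv
  by (subst bounded_linear_Blinfun_apply, intro bounded_linear_of_linear linearI)
    (simp_all add: br_simps F_simps H_simps blinfun.add_right blinfun.scaleR_right algebra_simps)

lemma bilinear_dorfman: "bilinear (dorfman br H F)"
  unfolding bilinear_def
  by (intro conjI allI linearI; clarify)
    (auto intro!: blinfun_eqI simp del: dorfman.simps simp: dorfman_eq dorfman_covector_apply
      br_simps F_simps H_simps blinfun.add_right blinfun.scaleR_right blinfun.add_left
      blinfun.scaleR_left algebra_simps)

text \<open>
  All induced basis vectors have the shape \<open>X + s g(X) + l\<close> with \<open>s \<in> {0, 1, -1}\<close>, so this one formula
  yields all structure constants of the bracket.
\<close>

lemma gen_scalar_dorfman:
  "gen_scalar (dorfman br H F (X, s *\<^sub>R flat g X, l) (Y, t *\<^sub>R flat g Y, m)) (Z, r *\<^sub>R flat g Z, n) =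
     (s * g X (br Y Z) - t * g Y (br X Z) + r * g Z (br X Y) + H Y X Z) / 2
      - m * F X Z + l * F Y Z + n * F X Y"
  by (simp del: dorfman.simps add: dorfman_eq dorfman_covector_apply gen_scalar.simps
      blinfun_apply_flat[OF bil_g] blinfun.scaleR_left field_simps)

abbreviation e :: "nat \<Rightarrow> 'g gen" where "e \<equiv> induced_basis g v"

text \<open>The coefficients \<open>0\<close>, \<open>1\<close> and \<open>-1\<close> are written out so that the formula above applies literally.\<close>

lemma e_eqs:
  "e 0 = (0, 0 *\<^sub>R flat g 0, 1)"
  "e 1 = (v 1, 1 *\<^sub>R flat g (v 1), 0)" "e 2 = (v 2, 1 *\<^sub>R flat g (v 2), 0)"
  "e 3 = (v 3, 1 *\<^sub>R flat g (v 3), 0)"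
  "e 4 = (v 1, (-1) *\<^sub>R flat g (v 1), 0)" "e 5 = (v 2, (-1) *\<^sub>R flat g (v 2), 0)"
  "e 6 = (v 3, (-1) *\<^sub>R flat g (v 3), 0)"
  by (simp_all add: induced_basis_def One_nat_def)

lemma gen_scalar_flat:
  "gen_scalar (X, s *\<^sub>R flat g X, l) (Y, t *\<^sub>R flat g Y, m) = (s + t) / 2 * g X Y + l * m"
  using g_sym[of Y X]
  by (simp add: gen_scalar.simps blinfun_apply_flat[OF bil_g] blinfun.scaleR_left field_simps)

lemma e_inner: "gen_scalar (e 0) (e 0) = 1"
  "gen_scalar (e 1) (e 1) = g (v 1) (v 1)" "gen_scalar (e 2) (e 2) = g (v 2) (v 2)"
  "gen_scalar (e 3) (e 3) = g (v 3) (v 3)" "gen_scalar (e 4) (e 4) = - g (v 1) (v 1)"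
  "gen_scalar (e 5) (e 5) = - g (v 2) (v 2)" "gen_scalar (e 6) (e 6) = - g (v 3) (v 3)"
  unfolding e_eqs gen_scalar_flat by (simp_all add: g_simps)

lemma E_minus_span: "E_minus g = span (e ` {4,5,6})"
proof -
  let ?L = "\<lambda>X. (X, - flat g X, 0::real)"
  have L: "linear ?L"
    using linear_flat[OF bil_g] by (intro linearI) (simp_all add: linear_add linear_cmul)
  have "E_minus g = ?L ` span (v ` {1,2,3})" unfolding v_span by (auto simp: E_minus_def)
  also have "\<dots> = span (?L ` v ` {1,2,3})" by (rule linear_span_image[OF L, symmetric])
  also have "?L ` v ` {1,2,3} = e ` {4,5,6}" by (simp add: e_eqs)
  finally show ?thesis .
qed

text \<open>
  Half sums and half differences of \<open>e a\<close> and \<open>e (a + 3)\<close> separate vectors from covectors, and every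
  covector is \<open>g(Y)\<close> for some \<open>Y\<close> since the frame is orthonormal.
\<close>

lemma e_span: "span (e ` ({0,1,2,3} \<union> {4,5,6})) = UNIV"
proof -
  let ?S = "span (e ` ({0,1,2,3} \<union> {4,5,6}))"
  have base: "e A \<in> ?S" if "A \<in> {0,1,2,3,4,5,6}" for A
    using that by (intro span_base imageI) auto
  have half: "(v a, 0, 0) \<in> ?S" "(0, flat g (v a), 0) \<in> ?S" if "a \<in> {1,2,3}" for a
  proof -
    have "(v a, 0, 0) = (1/2) *\<^sub>R (e a + e (a + 3))" "(0, flat g (v a), 0) = (1/2) *\<^sub>R (e a - e (a + 3))"
      using that by (auto simp: induced_basis_def scaleR_2[symmetric])
    moreover have "e a \<in> ?S" "e (a + 3) \<in> ?S" by (rule base, use that in force)+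
    note span_scale[OF span_add[OF this], of "1/2"] span_scale[OF span_diff[OF this], of "1/2"]
    ultimately show "(v a, 0, 0) \<in> ?S" "(0, flat g (v a), 0) \<in> ?S" by (simp_all only:)
  qed
  have X: "(X, 0, 0) \<in> ?S" for X
  proof -
    have "linear (\<lambda>X. (X, 0, 0) :: 'g gen)" by (intro linearI) auto
    then have "(\<lambda>X. (X, 0, 0) :: 'g gen) ` span (v ` {1,2,3}) = span ((\<lambda>X. (X, 0, 0)) ` v ` {1,2,3})"
      by (rule linear_span_image[symmetric])
    also have "\<dots> \<subseteq> ?S" using half by (intro span_minimal) auto
    finally show ?thesis using v_span by auto
  qed
  have fl: "(0, flat g X, 0) \<in> ?S" for X
  proof -
    have "linear (\<lambda>X. (0, flat g X, 0) :: 'g gen)"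
      using linear_flat[OF bil_g] by (intro linearI) (simp_all add: linear_add linear_cmul)
    then have "(\<lambda>X. (0, flat g X, 0) :: 'g gen) ` span (v ` {1,2,3}) = span ((\<lambda>X. (0, flat g X, 0)) ` v ` {1,2,3})"
      by (rule linear_span_image[symmetric])
    also have "\<dots> \<subseteq> ?S" using half by (intro span_minimal) auto
    finally show ?thesis using v_span by auto
  qed
  have "(X, \<xi>, l) \<in> ?S" for X \<xi> l
  proof -
    define Y where "Y = (\<Sum>a\<in>{1,2,3}. (blinfun_apply \<xi> (v a) / g (v a) (v a)) *\<^sub>R v a)"
    have "\<xi> = flat g Y"
    proof (rule blinfun_eqI)
      fix Z
      have "blinfun_apply \<xi> Z = (\<Sum>a\<in>{1,2,3}. g Z (v a) / g (v a) (v a) * blinfun_apply \<xi> (v a))"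
        using arg_cong[OF vf.expand[of Z], of "blinfun_apply \<xi>"] v_span
        by (simp add: blinfun.sum_right blinfun.add_right blinfun.scaleR_right)
      also have "\<dots> = g Y Z"
        by (simp add: Y_def g_simps g_sym[of Z] mult.commute)
      finally show "blinfun_apply \<xi> Z = blinfun_apply (flat g Y) Z"
        by (simp add: blinfun_apply_flat[OF bil_g])
    qed
    then have "(X, \<xi>, l) = (X, 0, 0) + (0, flat g Y, 0) + l *\<^sub>R e 0"
      by (simp add: e_eqs)
    then show ?thesis using X fl base[of 0] by (metis insertI1 span_add span_scale)
  qed
  then show ?thesis by auto
qed

lemma e_orth:
  assumes "A \<in> {0,1,2,3,4,5,6}" "B \<in> {0,1,2,3,4,5,6}" "A \<noteq> B"
  shows "gen_scalar (e A) (e B) = 0"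
  using assms
  by (elim insertE emptyE; hypsubst; (rule notE, assumption, rule refl)?;
      (simp only: e_eqs gen_scalar_flat; simp add: v_inner g_simps)?)

lemma e_nonnull:
  assumes "A \<in> {0,1,2,3,4,5,6}"
  shows "gen_scalar (e A) (e A) \<noteq> 0"
proof -
  have "g (v a) (v a) \<noteq> 0" if "a \<in> {1,2,3}" for a using v_sign[OF that] by auto
  then show ?thesis using assms by (elim insertE emptyE) (simp_all add: e_inner)
qed

sublocale ef: split_frame e "{0,1,2,3}" "{4,5,6}"
proof (intro split_frame.intro split_frame_axioms.intro orthogonal_frame.intro bilinear_gen_scalar e_span)
  show "gen_scalar (e i) (e j) = 0" if "i \<in> {0,1,2,3}" "j \<in> {0,1,2,3}" "i \<noteq> j" for i j
    by (rule e_orth) (use that in blast)+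
  show "gen_scalar (e i) (e j) = 0" if "i \<in> {4,5,6}" "j \<in> {4,5,6}" "i \<noteq> j" for i j
    by (rule e_orth) (use that in blast)+
  show "gen_scalar (e i) (e j) = 0" if "i \<in> {0,1,2,3}" "j \<in> {4,5,6}" for i j
    by (rule e_orth) (use that in auto)
  show "gen_scalar (e i) (e i) \<noteq> 0" if "i \<in> {0,1,2,3}" for i
    by (rule e_nonnull) (use that in blast)
  show "gen_scalar (e i) (e i) \<noteq> 0" if "i \<in> {4,5,6}" for i
    by (rule e_nonnull) (use that in blast)
qed simp_all

end

section \<open>Case 7 is generalized Einstein\<close>

context invariant_frame begin

text \<open>
  Up to sign, the components with indices \<open>(0,4), (0,6), (1,4), (3,6)\<close> are the first four
  case 7 relations, those with indices \<open>(1,6), (3,4)\<close> are the last one, and \<open>(2,5)\<close> is the fifth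
  with the squares of the components of \<open>F\<close> substituted; all other components vanish identically. The two
  curvatures have the same components because the bracket is totally skew and \<open>\<delta>\<^sub>2 = \<delta>\<^sub>5\<close>.
\<close>

lemma mixed_ricci_zero:
  assumes br13: "br (v 1) (v 3) = 0"
    and br21: "br (v 2) (v 1) = (g (v 1) (v 1) * lam) *\<^sub>R v 1 + (g (v 3) (v 3) * \<mu>) *\<^sub>R v 3"
    and br23: "br (v 2) (v 3) = (g (v 1) (v 1) * \<nu>) *\<^sub>R v 1 + (g (v 3) (v 3) * \<rho>) *\<^sub>R v 3"
    and rel: "case7_relations (\<lambda>a. g (v a) (v a)) lam \<mu> \<nu> \<rho> (H (v 1) (v 2) (v 3))
        (\<lambda>a b. F (v a) (v b)) (\<lambda>A. \<delta> (e A))"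
    and A: "A \<in> {0,1,2,3}" and B: "B \<in> {4,5,6}"
  shows "mixed_ricci e {0,1,2,3} {4,5,6} (dorfman br H F) \<delta> (e B) (e A) = 0"
    and "mixed_ricci e {4,5,6} {0,1,2,3} (dorfman br H F) \<delta> (e A) (e B) = 0"
proof -
  define p q d where "p = F (v 1) (v 2)" and "q = F (v 2) (v 3)" and "d = \<delta> (e 2)"
  have br: "br (v 3) (v 1) = 0" "br (v a) (v a) = 0"
    "br (v 1) (v 2) = - ((g (v 1) (v 1) * lam) *\<^sub>R v 1 + (g (v 3) (v 3) * \<mu>) *\<^sub>R v 3)"
    "br (v 3) (v 2) = - ((g (v 1) (v 1) * \<nu>) *\<^sub>R v 1 + (g (v 3) (v 3) * \<rho>) *\<^sub>R v 3)" for a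
    using br_swap[of "v 3" "v 1"] br_swap[of "v 1" "v 2"] br_swap[of "v 3" "v 2"] br_self br13 br21 br23
    by simp_all
  note van = rel[unfolded case7_relations_def vanishing_components_def]
  have F: "F (v a) (v a) = 0" "F (v 1) (v 3) = 0" "F (v 3) (v 1) = 0" "F (v 1) (v 2) = p" "F (v 2) (v 1) = - p"
    "F (v 2) (v 3) = q" "F (v 3) (v 2) = - q" for a
    using F_swap[of "v 3" "v 1"] F_swap[of "v 2" "v 1"] F_swap[of "v 3" "v 2"] F_self van
    by (simp_all add: p_def q_def)
  have \<delta>: "\<delta> (e 0) = 0" "\<delta> (e 1) = 0" "\<delta> (e 2) = d" "\<delta> (e 3) = 0" "\<delta> (e 4) = 0" "\<delta> (e 5) = d" "\<delta> (e 6) = 0"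
    using van by (simp_all add: d_def)
  have "H (v 1) (v 2) (v 3) = 0" using van by blast
  note H = H_basis_zero[OF this]
  have rels: "p * g (v 3) (v 3) * (d + g (v 1) (v 1) * lam) = q * \<nu>"
    "p * \<mu> = q * g (v 1) (v 1) * (g (v 3) (v 3) * \<rho> + d)"
    "p\<^sup>2 = g (v 3) (v 3) / 2 * (\<nu>\<^sup>2 - \<mu>\<^sup>2) + d * lam"
    "q\<^sup>2 = g (v 1) (v 1) / 2 * (\<mu>\<^sup>2 - \<nu>\<^sup>2) + d * \<rho>"
    "d * (g (v 1) (v 1) * lam + g (v 3) (v 3) * \<rho>) =
       - lam\<^sup>2 - g (v 1) (v 1) * g (v 3) (v 3) / 2 * (\<mu> + \<nu>)\<^sup>2 - \<rho>\<^sup>2"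
    "p * q = g (v 1) (v 1) / 2 * lam * (\<nu> - \<mu>) + g (v 3) (v 3) / 2 * \<rho> * (\<mu> - \<nu>) - d / 2 * (\<mu> + \<nu>)"
    unfolding p_def q_def d_def using van by blast+
  note tab = br br13 br21 br23 F \<delta> H v_inner
  \<comment> \<open>With the signs replaced by numbers, every component is a linear combination of the relations.\<close>
  have s: "(g (v 1) (v 1) = 1 \<or> g (v 1) (v 1) = -1)" "(g (v 2) (v 2) = 1 \<or> g (v 2) (v 2) = -1)"
    "(g (v 3) (v 3) = 1 \<or> g (v 3) (v 3) = -1)" by (simp_all add: v_sign)
  have "\<forall>A\<in>{0,1,2,3}. \<forall>B\<in>{4,5,6}.
      mixed_ricci e {0,1,2,3} {4,5,6} (dorfman br H F) \<delta> (e B) (e A) = 0 \<and>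
      mixed_ricci e {4,5,6} {0,1,2,3} (dorfman br H F) \<delta> (e A) (e B) = 0"
    using s unfolding ball_simps
    by (elim disjE; intro conjI TrueI; simp only: mixed_ricci_def; simp add: \<delta> e_inner;
        simp only: e_eqs gen_scalar_dorfman; simp add: tab g_simps F_simps br_simps H_simps;
        insert rels; simp add: power2_eq_square algebra_simps add_divide_distrib diff_divide_distrib;
        linarith)
  then show "mixed_ricci e {0,1,2,3} {4,5,6} (dorfman br H F) \<delta> (e B) (e A) = 0"
    and "mixed_ricci e {4,5,6} {0,1,2,3} (dorfman br H F) \<delta> (e A) (e B) = 0"
    using A B by blast+
qed

theorem case7_generalized_einstein:
  assumes br13: "br (v 1) (v 3) = 0"
    and br21: "br (v 2) (v 1) = (g (v 1) (v 1) * lam) *\<^sub>R v 1 + (g (v 3) (v 3) * \<mu>) *\<^sub>R v 3"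
    and br23: "br (v 2) (v 3) = (g (v 1) (v 1) * \<nu>) *\<^sub>R v 1 + (g (v 3) (v 3) * \<rho>) *\<^sub>R v 3"
    and rel: "case7_relations (\<lambda>a. g (v a) (v a)) lam \<mu> \<nu> \<rho> (H (v 1) (v 2) (v 3))
        (\<lambda>a b. F (v a) (v b)) (\<lambda>A. \<delta> (e A))"
    and lin: "linear \<delta>"
  shows "generalized_einstein (dorfman br H F) (E_minus g) \<delta>"
  unfolding E_minus_span
  by (intro ef.generalized_einstein_if_mixed_ricci_zero bilinear_dorfman lin
      mixed_ricci_zero[OF br13 br21 br23 rel])

end

section \<open>Solving the case 7 relations\<close>

text \<open>
  Here \<open>p = F\<^sub>1\<^sub>2\<close> and \<open>q = F\<^sub>2\<^sub>3\<close>. Dividing the two relations that are linear in the components of \<open>F\<close>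
  determines \<open>r\<close>, and comparing the values of \<open>p\<^sup>2\<close> and \<open>pq\<close> eliminates \<open>p\<close>; the resulting equation
  factorizes, and each factor is one alternative.
\<close>

lemma family_conditions_if_case7:
  fixes e1 e3 lam \<mu> \<nu> \<rho> a r d p q :: real
  assumes sq: "e1\<^sup>2 = 1" "e3\<^sup>2 = 1"
    and a: "a = d + e1 * lam" and r: "r = d + e3 * \<rho>"
    and tr: "e1 * lam + e3 * \<rho> \<noteq> 0"
    and nz: "\<mu> \<noteq> 0" "\<nu> \<noteq> 0" "p \<noteq> 0" "q \<noteq> 0"
    and h1: "p * e3 * (d + e1 * lam) = q * \<nu>"
    and h2: "p * \<mu> = q * e1 * (e3 * \<rho> + d)"
    and hA: "p\<^sup>2 = e3 / 2 * (\<nu>\<^sup>2 - \<mu>\<^sup>2) + d * lam"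
    and hC: "d * (e1 * lam + e3 * \<rho>) = - lam\<^sup>2 - e1 * e3 / 2 * (\<mu> + \<nu>)\<^sup>2 - \<rho>\<^sup>2"
    and hD: "p * q = e1 / 2 * lam * (\<nu> - \<mu>) + e3 / 2 * \<rho> * (\<mu> - \<nu>) - d / 2 * (\<mu> + \<nu>)"
  shows "a \<noteq> 0" and "q = p * e3 * (a / \<nu>)" and "r = e1 * e3 * (\<mu> * \<nu> / a)"
    and "\<mu> = \<nu> \<and> d = a + e1 * e3 * (\<mu>\<^sup>2 / a) \<and> p\<^sup>2 = - (\<mu> / a)\<^sup>2 * (e3 * a\<^sup>2 + e1 * \<mu>\<^sup>2) \<or>
      a\<^sup>2 \<noteq> \<nu>\<^sup>2 \<and> e3 = - e1 \<and>
        (\<exists>s\<in>{1, -1}. d = s / 2 * (\<nu> - \<mu>) \<and> a\<^sup>2 + s / 2 * (\<nu> - \<mu>) * a - \<mu> * \<nu> = 0 \<and>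
          p\<^sup>2 = e1 * (\<nu> - \<mu>) * \<nu> * (s * (\<mu> / (2 * a)) - 1))"
proof -
  have lam: "lam = e1 * (a - d)" and rho: "\<rho> = e3 * (r - d)"
    using sq a r by algebra+
  have pa: "p * e3 * a = q * \<nu>" and pm: "p * \<mu> = q * e1 * r" using h1 h2 a r by (simp_all add: add.commute)
  show a0: "a \<noteq> 0" using pa nz by auto
  show "q = p * e3 * (a / \<nu>)" using pa nz by (simp add: field_simps)
  have "p * q * (a * r) = p * q * (e1 * e3 * \<mu> * \<nu>)" using pa pm sq by algebra
  then have ar: "a * r = e1 * e3 * \<mu> * \<nu>" using nz by simp
  then show r_eq: "r = e1 * e3 * (\<mu> * \<nu> / a)" using a0 by (simp add: field_simps)
  have A: "2 * p\<^sup>2 = e3 * (\<nu>\<^sup>2 - \<mu>\<^sup>2) + 2 * d * e1 * (a - d)"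
    using hA lam by simp
  have C: "2 * (a + r) * (a + r - d) + e1 * e3 * (\<nu> - \<mu>)\<^sup>2 = 0"
  proof -
    have "2 * d * (e1 * lam + e3 * \<rho>) = - 2 * lam\<^sup>2 - e1 * e3 * (\<mu> + \<nu>)\<^sup>2 - 2 * \<rho>\<^sup>2"
      using hC by (simp add: field_simps)
    then show ?thesis using lam rho ar sq by algebra
  qed
  have D: "2 * p * q = (\<nu> - \<mu>) * (a - r) - d * (\<mu> + \<nu>)"
  proof -
    have "2 * p * q = e1 * lam * (\<nu> - \<mu>) + e3 * \<rho> * (\<mu> - \<nu>) - d * (\<mu> + \<nu>)"
      using hD by (simp add: field_simps)
    then show ?thesis using lam rho sq by algebra
  qed
  have E: "e3 * a * (e3 * (\<nu>\<^sup>2 - \<mu>\<^sup>2) + 2 * d * e1 * (a - d)) = \<nu> * ((\<nu> - \<mu>) * (a - r) - d * (\<mu> + \<nu>))"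
    using A D pa by algebra
  show "\<mu> = \<nu> \<and> d = a + e1 * e3 * (\<mu>\<^sup>2 / a) \<and> p\<^sup>2 = - (\<mu> / a)\<^sup>2 * (e3 * a\<^sup>2 + e1 * \<mu>\<^sup>2) \<or>
      a\<^sup>2 \<noteq> \<nu>\<^sup>2 \<and> e3 = - e1 \<and>
        (\<exists>s\<in>{1, -1}. d = s / 2 * (\<nu> - \<mu>) \<and> a\<^sup>2 + s / 2 * (\<nu> - \<mu>) * a - \<mu> * \<nu> = 0 \<and>
          p\<^sup>2 = e1 * (\<nu> - \<mu>) * \<nu> * (s * (\<mu> / (2 * a)) - 1))" (is "?i \<or> ?ii")
  proof (cases "\<mu> = \<nu>")
    case True
    have d0: "d \<noteq> 0" using A True nz by auto
    have "d * a * (a + r - d) = 0" using E True ar sq by algebra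
    then have d: "d = a + r" using d0 a0 by simp
    have "a\<^sup>2 * p\<^sup>2 = - (\<mu>\<^sup>2 * (e3 * a\<^sup>2 + e1 * \<mu>\<^sup>2))" using A d ar True sq by algebra
    then have "p\<^sup>2 = - (\<mu> / a)\<^sup>2 * (e3 * a\<^sup>2 + e1 * \<mu>\<^sup>2)"
      using a0 by (simp add: field_simps power_divide)
    then show ?thesis using True d r_eq by (simp add: power2_eq_square)
  next
    case False
    \<comment> \<open>The elimination equation \<open>E\<close> times \<open>a + r\<close>, reduced with \<open>C\<close> and \<open>ar\<close>.\<close>
    have key: "(\<nu> - \<mu>) * ((d + (a + r)) * (\<nu> * r + a * \<mu>)) = 0"
      using E C ar sq by algebra
    have e: "e1 = 1 \<or> e1 = -1" "e3 = 1 \<or> e3 = -1" using sq by (simp_all add: power2_eq_1_iff)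
    have pos: "(\<nu> - \<mu>)\<^sup>2 > 0" "a\<^sup>2 > 0" "\<nu>\<^sup>2 > 0" using False a0 nz by auto
    have trace: "a + r \<noteq> 2 * d" using tr a r by auto
    have no_square: "d + (a + r) = 0 \<Longrightarrow> e3 = - e1 \<Longrightarrow> a\<^sup>2 \<noteq> \<nu>\<^sup>2"
    proof
      assume ds: "d + (a + r) = 0" and e31: "e3 = - e1" and "a\<^sup>2 = \<nu>\<^sup>2"
      then have "(a + r)\<^sup>2 * a\<^sup>2 = (\<nu> - \<mu>)\<^sup>2 * a\<^sup>2" using ar sq by algebra
      then have "(a + r)\<^sup>2 = (\<nu> - \<mu>)\<^sup>2" using a0 by simp
      moreover have "4 * (a + r)\<^sup>2 = (\<nu> - \<mu>)\<^sup>2" using C ds e31 sq by algebra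
      ultimately show False using pos by simp
    qed
    \<comment> \<open>This factor forces \<open>(a, r) = (\<nu>, -\<mu>)\<close> or \<open>(a, r) = (-\<nu>, \<mu>)\<close>, and then the trace of \<open>ad v\<^sub>2\<close> is zero.\<close>
    have "\<nu> * r + a * \<mu> \<noteq> 0"
    proof
      assume z: "\<nu> * r + a * \<mu> = 0"
      have "\<mu> * (a\<^sup>2 + e1 * e3 * \<nu>\<^sup>2) = 0" using z ar by algebra
      then have z2: "a\<^sup>2 + e1 * e3 * \<nu>\<^sup>2 = 0" using nz by simp
      then have e31: "e1 * e3 = -1" using e pos by (auto simp: add_pos_pos)
      then have "a\<^sup>2 = \<nu>\<^sup>2" using z2 by simp
      then have "a = \<nu> \<or> a = - \<nu>" by (simp add: power2_eq_iff)
      then show False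
      proof
        assume an: "a = \<nu>"
        then have rm: "r = - \<mu>" using z nz by (metis add_eq_0_iff2 mult_cancel_left mult_minus_right add.commute)
        have "(\<nu> - \<mu>) * (a + r - 2 * d) = 0" using C an rm e31 by algebra
        then show False using False trace by simp
      next
        assume an: "a = - \<nu>"
        then have "\<nu> * (r - \<mu>) = 0" using z by (simp add: algebra_simps)
        then have rm: "r = \<mu>" using nz by simp
        have "(\<nu> - \<mu>) * (a + r - 2 * d) = 0" using C an rm e31 by algebra
        then show False using False trace by simp
      qed
    qed
    then have ds: "d + (a + r) = 0" using key False by auto
    then have "4 * (a + r)\<^sup>2 + e1 * e3 * (\<nu> - \<mu>)\<^sup>2 = 0" using C by algebra
    then have e31: "e3 = - e1" using e pos by (auto simp: add_nonneg_eq_0_iff)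
    have "4 * d\<^sup>2 = (\<nu> - \<mu>)\<^sup>2" using C ds e31 sq by algebra
    then have "(2 * d)\<^sup>2 = (\<nu> - \<mu>)\<^sup>2" by (simp add: power2_eq_square)
    then have "2 * d = \<nu> - \<mu> \<or> 2 * d = - (\<nu> - \<mu>)" by (simp only: power2_eq_iff)
    then obtain s :: real where s: "s \<in> {1, -1}" and sd: "2 * d = s * (\<nu> - \<mu>)"
      by (metis insert_iff mult_1 mult_minus1)
    have s2: "s\<^sup>2 = 1" using s by auto
    have "2 * a\<^sup>2 + 2 * d * a - 2 * \<mu> * \<nu> = 0" using ar ds e31 sq by algebra
    then have "2 * a\<^sup>2 + s * (\<nu> - \<mu>) * a - 2 * \<mu> * \<nu> = 0" using sd by simp
    then have quad: "a\<^sup>2 + s / 2 * (\<nu> - \<mu>) * a - \<mu> * \<nu> = 0" by (simp add: field_simps)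
    have "2 * a * p\<^sup>2 = e1 * (\<nu> - \<mu>) * \<nu> * (s * \<mu> - 2 * a)"
    proof -
      have "2 * (2 * a * p\<^sup>2) = 2 * (e1 * (\<nu> - \<mu>) * \<nu> * (s * \<mu> - 2 * a))"
        using A ar ds e31 sd s2 sq by algebra
      then show ?thesis by (simp only: mult_cancel_left) simp
    qed
    then have "p\<^sup>2 = e1 * (\<nu> - \<mu>) * \<nu> * (s * (\<mu> / (2 * a)) - 1)" using a0 by (simp add: field_simps)
    moreover have "d = s / 2 * (\<nu> - \<mu>)" using sd by simp
    ultimately show ?thesis using no_square[OF ds e31] e31 s quad by blast
  qed
qed

text \<open>
  In both families \<open>d\<close> is \<open>a + r\<close> up to sign. Together with the given \<open>p\<^sup>2\<close> and, in the second
  family, \<open>4d\<^sup>2 = (\<nu>-\<mu>)\<^sup>2\<close> this makes the relations without \<open>q\<^sup>2\<close> identities. The relation for \<open>q\<^sup>2\<close> is the mirror image of that for \<open>p\<^sup>2\<close> under exchanging the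
  indices \<open>1\<close> and \<open>3\<close>.
\<close>

lemma case7_if_family_conditions:
  fixes e1 e3 lam \<mu> \<nu> \<rho> a r d p q :: real
  assumes sq: "e1\<^sup>2 = 1" "e3\<^sup>2 = 1"
    and a: "a = d + e1 * lam" and r: "r = d + e3 * \<rho>"
    and nz: "a \<noteq> 0" "\<mu> \<noteq> 0" "\<nu> \<noteq> 0"
    and q_eq: "q = p * e3 * (a / \<nu>)" and r_eq: "r = e1 * e3 * (\<mu> * \<nu> / a)"
    and fam: "\<mu> = \<nu> \<and> d = a + e1 * e3 * (\<mu>\<^sup>2 / a) \<and> p\<^sup>2 = - (\<mu> / a)\<^sup>2 * (e3 * a\<^sup>2 + e1 * \<mu>\<^sup>2) \<or>
      e3 = - e1 \<and>
        (\<exists>s\<in>{1, -1}. d = s / 2 * (\<nu> - \<mu>) \<and> a\<^sup>2 + s / 2 * (\<nu> - \<mu>) * a - \<mu> * \<nu> = 0 \<and>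
          p\<^sup>2 = e1 * (\<nu> - \<mu>) * \<nu> * (s * (\<mu> / (2 * a)) - 1))"
  shows "p * e3 * (d + e1 * lam) = q * \<nu>"
    and "p * \<mu> = q * e1 * (e3 * \<rho> + d)"
    and "p\<^sup>2 = e3 / 2 * (\<nu>\<^sup>2 - \<mu>\<^sup>2) + d * lam"
    and "q\<^sup>2 = e1 / 2 * (\<mu>\<^sup>2 - \<nu>\<^sup>2) + d * \<rho>"
    and "d * (e1 * lam + e3 * \<rho>) = - lam\<^sup>2 - e1 * e3 / 2 * (\<mu> + \<nu>)\<^sup>2 - \<rho>\<^sup>2"
    and "p * q = e1 / 2 * lam * (\<nu> - \<mu>) + e3 / 2 * \<rho> * (\<mu> - \<nu>) - d / 2 * (\<mu> + \<nu>)"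
proof -
  have lam: "lam = e1 * (a - d)" and rho: "\<rho> = e3 * (r - d)"
    using sq a r by algebra+
  have ar: "a * r = e1 * e3 * \<mu> * \<nu>" using r_eq nz by (simp add: field_simps)
  have pa: "q * \<nu> = p * e3 * a" using q_eq nz by (simp add: field_simps)
  show "p * e3 * (d + e1 * lam) = q * \<nu>" using pa a by simp
  have "\<nu> * (p * \<mu>) = \<nu> * (q * e1 * r)" using pa ar sq by algebra
  then show "p * \<mu> = q * e1 * (e3 * \<rho> + d)" using nz r by (simp add: add.commute)
  have "2 * p\<^sup>2 = e3 * (\<nu>\<^sup>2 - \<mu>\<^sup>2) + 2 * d * e1 * (a - d) \<and>
      2 * (a + r) * (a + r - d) + e1 * e3 * (\<nu> - \<mu>)\<^sup>2 = 0 \<and>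
      2 * e3 * a * p\<^sup>2 = \<nu> * ((\<nu> - \<mu>) * (a - r) - d * (\<mu> + \<nu>))"
    using fam
  proof (elim disjE conjE bexE)
    assume eq: "\<mu> = \<nu>" and d: "d = a + e1 * e3 * (\<mu>\<^sup>2 / a)"
      and p2: "p\<^sup>2 = - (\<mu> / a)\<^sup>2 * (e3 * a\<^sup>2 + e1 * \<mu>\<^sup>2)"
    have ds: "d = a + r" using d r_eq eq by (simp add: power2_eq_square)
    have "a\<^sup>2 * p\<^sup>2 = - (\<mu>\<^sup>2 * (e3 * a\<^sup>2 + e1 * \<mu>\<^sup>2))"
      using p2 nz by (simp add: power_divide)
    then have "a\<^sup>2 * p\<^sup>2 = a\<^sup>2 * (- e1 * r * (a + r))" using ar eq sq by algebra
    then have p2': "p\<^sup>2 = - e1 * r * (a + r)" unfolding mult_cancel_left using nz by simp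
    show ?thesis using ds p2' ar eq sq by (intro conjI; algebra)
  next
    fix s :: real
    assume e31: "e3 = - e1" and s: "s \<in> {1, -1}" and d: "d = s / 2 * (\<nu> - \<mu>)"
      and quad: "a\<^sup>2 + s / 2 * (\<nu> - \<mu>) * a - \<mu> * \<nu> = 0"
      and p2: "p\<^sup>2 = e1 * (\<nu> - \<mu>) * \<nu> * (s * (\<mu> / (2 * a)) - 1)"
    have s2: "s\<^sup>2 = 1" and sd: "2 * d = s * (\<nu> - \<mu>)" using s d by auto
    have "a * (d + (a + r)) = 0" using quad[folded d] ar e31 sq by algebra
    then have ds: "d + (a + r) = 0" using nz by simp
    have "2 * a * p\<^sup>2 = e1 * (\<nu> - \<mu>) * \<nu> * (s * \<mu> - 2 * a)" using p2 nz by (simp add: field_simps)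
    then have "2 * a * (2 * p\<^sup>2) = 2 * a * (e3 * (\<nu>\<^sup>2 - \<mu>\<^sup>2) + 2 * d * e1 * (a - d))"
      using ar ds e31 sd s2 sq by algebra
    then have p2': "2 * p\<^sup>2 = e3 * (\<nu>\<^sup>2 - \<mu>\<^sup>2) + 2 * d * e1 * (a - d)" unfolding mult_cancel_left using nz by simp
    have dd: "4 * d\<^sup>2 = (\<nu> - \<mu>)\<^sup>2" using sd s2 by algebra
    have "2 * (2 * e3 * a * p\<^sup>2) = 2 * (\<nu> * ((\<nu> - \<mu>) * (a - r) - d * (\<mu> + \<nu>)))"
      using p2' dd ar ds e31 sq by algebra
    then show ?thesis using p2' dd ds e31 sq by (intro conjI; algebra)
  qed
  then have A: "2 * p\<^sup>2 = e3 * (\<nu>\<^sup>2 - \<mu>\<^sup>2) + 2 * d * e1 * (a - d)"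
    and C: "2 * (a + r) * (a + r - d) + e1 * e3 * (\<nu> - \<mu>)\<^sup>2 = 0"
    and D: "2 * e3 * a * p\<^sup>2 = \<nu> * ((\<nu> - \<mu>) * (a - r) - d * (\<mu> + \<nu>))" by auto
  show "p\<^sup>2 = e3 / 2 * (\<nu>\<^sup>2 - \<mu>\<^sup>2) + d * lam" using A lam by simp
  have "\<nu> * (2 * p * q) = \<nu> * ((\<nu> - \<mu>) * (a - r) - d * (\<mu> + \<nu>))" using D pa by algebra
  then have pq: "2 * p * q = (\<nu> - \<mu>) * (a - r) - d * (\<mu> + \<nu>)" unfolding mult_cancel_left using nz by simp
  have "2 * p * q = e1 * lam * (\<nu> - \<mu>) + e3 * \<rho> * (\<mu> - \<nu>) - d * (\<mu> + \<nu>)"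
    using pq lam rho sq by algebra
  then show "p * q = e1 / 2 * lam * (\<nu> - \<mu>) + e3 / 2 * \<rho> * (\<mu> - \<nu>) - d / 2 * (\<mu> + \<nu>)"
    by (simp add: field_simps)
  have "2 * d * (e1 * lam + e3 * \<rho>) = - 2 * lam\<^sup>2 - e1 * e3 * (\<mu> + \<nu>)\<^sup>2 - 2 * \<rho>\<^sup>2"
    using C lam rho ar sq by algebra
  then show "d * (e1 * lam + e3 * \<rho>) = - lam\<^sup>2 - e1 * e3 / 2 * (\<mu> + \<nu>)\<^sup>2 - \<rho>\<^sup>2"
    by (simp add: field_simps)
  have E: "e3 * a * (e3 * (\<nu>\<^sup>2 - \<mu>\<^sup>2) + 2 * d * e1 * (a - d)) = \<nu> * ((\<nu> - \<mu>) * (a - r) - d * (\<mu> + \<nu>))"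
    using A D by algebra
  \<comment> \<open>The mirror image of \<open>E\<close>: modulo \<open>ar\<close>, the sum of both equations is a multiple of \<open>C\<close>.\<close>
  have E': "e1 * r * (e1 * (\<mu>\<^sup>2 - \<nu>\<^sup>2) + 2 * d * e3 * (r - d)) = \<mu> * ((\<nu> - \<mu>) * (a - r) - d * (\<mu> + \<nu>))"
    using E C ar sq by algebra
  have qr: "e1 * r * q = p * \<mu>"
    using \<open>\<nu> * (p * \<mu>) = \<nu> * (q * e1 * r)\<close> nz by simp
  have "e1 * r * (2 * q\<^sup>2) = \<mu> * (2 * p * q)" using qr by algebra
  then have "e1 * r * (2 * q\<^sup>2) = e1 * r * (e1 * (\<mu>\<^sup>2 - \<nu>\<^sup>2) + 2 * d * e3 * (r - d))"
    using pq E' by algebra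
  moreover have "e1 * r \<noteq> 0" using ar nz sq by auto
  ultimately have "2 * q\<^sup>2 = e1 * (\<mu>\<^sup>2 - \<nu>\<^sup>2) + 2 * d * e3 * (r - d)" unfolding mult_cancel_left by blast
  then have "2 * q\<^sup>2 = e1 * (\<mu>\<^sup>2 - \<nu>\<^sup>2) + 2 * d * \<rho>" using rho by simp
  then show "q\<^sup>2 = e1 / 2 * (\<mu>\<^sup>2 - \<nu>\<^sup>2) + d * \<rho>" by (simp add: field_simps)
qed

section \<open>The isomorphism type\<close>

lemma diag2_mult: "diag2 a b *v x = vector [a * x $ 1, b * x $ 2]"
  by (simp add: diag2_def vec_eq_iff matrix_vector_mult_def sum_2 forall_2)

context invariant_frame begin

definition coord :: "nat \<Rightarrow> 'g \<Rightarrow> real" where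
  "coord a x = g x (v a) / g (v a) (v a)"

lemma linear_coord: "linear (coord a)"
  by (rule linearI) (simp_all add: coord_def g_simps add_divide_distrib)

lemma coord_expand: "x = coord 1 x *\<^sub>R v 1 + coord 2 x *\<^sub>R v 2 + coord 3 x *\<^sub>R v 3"
  using vf.expand[of x] v_span by (simp add: coord_def add.assoc)

lemma coord_v: "coord 1 (v 1) = 1" "coord 2 (v 1) = 0" "coord 3 (v 1) = 0"
  "coord 1 (v 2) = 0" "coord 2 (v 2) = 1" "coord 3 (v 2) = 0"
  "coord 1 (v 3) = 0" "coord 2 (v 3) = 0" "coord 3 (v 3) = 1"
  using v_sign[of 1] v_sign[of 2] v_sign[of 3] by (auto simp: coord_def v_inner)

lemma br_expand:
  assumes "br (v 1) (v 3) = 0"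
  shows "br x y = (coord 2 x * coord 1 y - coord 2 y * coord 1 x) *\<^sub>R br (v 2) (v 1) +
    (coord 2 x * coord 3 y - coord 2 y * coord 3 x) *\<^sub>R br (v 2) (v 3)"
proof -
  have v31: "br (v 3) (v 1) = 0" using br_swap[of "v 3" "v 1"] assms by simp
  have "br x y = br (coord 1 x *\<^sub>R v 1 + coord 2 x *\<^sub>R v 2 + coord 3 x *\<^sub>R v 3)
      (coord 1 y *\<^sub>R v 1 + coord 2 y *\<^sub>R v 2 + coord 3 y *\<^sub>R v 3)"
    by (rule arg_cong2[OF coord_expand coord_expand])
  also have "\<dots> = (coord 2 x * coord 1 y - coord 2 y * coord 1 x) *\<^sub>R br (v 2) (v 1) +
    (coord 2 x * coord 3 y - coord 2 y * coord 3 x) *\<^sub>R br (v 2) (v 3)"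
    by (simp add: br_simps assms v31 br_self br_swap[of "v 1" "v 2"] br_swap[of "v 3" "v 2"] algebra_simps)
  finally show ?thesis .
qed

text \<open>
  The coordinates \<open>\<phi> \<alpha>\<close> and \<open>\<phi> \<beta>\<close> are left eigenvectors of the matrix of \<open>ad v\<^sub>2\<close>. They are independent
  because \<open>a12 \<noteq> 0\<close> and the eigenvalues differ, so no eigenbasis has to be constructed. The factor \<open>\<alpha>\<close>
  in the first component rescales the generator to make the first eigenvalue \<open>1\<close>.
\<close>

theorem lie_isomorphic_semidirect_diag:
  assumes dim: "DIM('g) = 3"
    and br13: "br (v 1) (v 3) = 0"
    and br21: "br (v 2) (v 1) = a11 *\<^sub>R v 1 + a21 *\<^sub>R v 3"
    and br23: "br (v 2) (v 3) = a12 *\<^sub>R v 1 + a22 *\<^sub>R v 3"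
    and a12: "a12 \<noteq> 0"
    and trace: "a11 + a22 = \<alpha> + \<beta>" and det: "a11 * a22 - a12 * a21 = \<alpha> * \<beta>"
    and \<alpha>: "\<alpha> \<noteq> 0" and distinct: "\<alpha> \<noteq> \<beta>"
  shows "lie_isomorphic br (semidirect_bracket (diag2 1 (\<beta> / \<alpha>)))"
proof -
  define \<phi> where "\<phi> \<kappa> x = (\<kappa> - a22) * coord 1 x + a12 * coord 3 x" for \<kappa> x
  define f :: "'g \<Rightarrow> real \<times> (real^2)" where
    "f x = (\<alpha> * coord 2 x, vector [\<phi> \<alpha> x, \<phi> \<beta> x])" for x
  note lc = linear_add[OF linear_coord] linear_diff[OF linear_coord] linear_cmul[OF linear_coord]
  have lin: "linear f"
    by (rule linearI) (simp_all add: f_def \<phi>_def lc vec_eq_iff forall_2 algebra_simps)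
  have "x = 0" if "f x = 0" for x
  proof -
    have c2: "coord 2 x = 0" and a: "\<phi> \<alpha> x = 0" and b: "\<phi> \<beta> x = 0"
      using that \<alpha> by (auto simp: f_def zero_prod_def vec_eq_iff forall_2)
    have "(\<alpha> - \<beta>) * coord 1 x = \<phi> \<alpha> x - \<phi> \<beta> x" by (simp add: \<phi>_def algebra_simps)
    then have c1: "coord 1 x = 0" using a b distinct by simp
    then have "coord 3 x = 0" using a a12 by (simp add: \<phi>_def)
    then show ?thesis using coord_expand[of x] c1 c2 by simp
  qed
  then have inj: "inj f" using lin by (simp add: linear_injective_0)
  have "dim (range f) = DIM(real \<times> (real^2))"
    using dim_image_eq[OF lin, of UNIV] inj dim by simp
  then have "surj f"
    using dim_eq_full[of "range f"] linear_subspace_image[OF lin subspace_UNIV] by (simp add: span_eq_iff[THEN iffD2])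
  then have bij: "bij f" using inj by (simp add: bij_def)
  have eigen: "\<phi> \<kappa> (br x y) = \<kappa> * (coord 2 x * \<phi> \<kappa> y - coord 2 y * \<phi> \<kappa> x)"
    if "\<kappa> = \<alpha> \<or> \<kappa> = \<beta>" for \<kappa> x y
  proof -
    have "(\<kappa> - a11) * (\<kappa> - a22) = a12 * a21" using that trace det by (elim disjE) algebra+
    moreover have "\<phi> \<kappa> (br x y) =
        (coord 2 x * coord 1 y - coord 2 y * coord 1 x) * ((\<kappa> - a22) * a11 + a12 * a21) +
        (coord 2 x * coord 3 y - coord 2 y * coord 3 x) * (\<kappa> * a12)"
      by (subst br_expand[OF br13]) (simp add: \<phi>_def br21 br23 lc coord_v algebra_simps)
    ultimately show ?thesis unfolding \<phi>_def by algebra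
  qed
  have "coord 2 (br x y) = 0" for x y
    by (subst br_expand[OF br13]) (simp add: br21 br23 lc coord_v)
  then have "f (br x y) = semidirect_bracket (diag2 1 (\<beta> / \<alpha>)) (f x) (f y)" for x y
    using \<alpha> by (simp add: f_def semidirect_bracket_def diag2_mult eigen vec_eq_iff forall_2 field_simps)
  then show ?thesis unfolding lie_isomorphic_def using lin bij by blast
qed

end

section \<open>The classification\<close>

theorem corollary48:
  fixes br :: "'g::euclidean_space \<Rightarrow> 'g \<Rightarrow> 'g"
    and g F :: "'g \<Rightarrow> 'g \<Rightarrow> real"
    and H :: "'g \<Rightarrow> 'g \<Rightarrow> 'g \<Rightarrow> real"
    and \<delta> :: "'g gen \<Rightarrow> real"
    and v :: "nat \<Rightarrow> 'g"
    and \<epsilon> dc :: "nat \<Rightarrow> real"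
    and Fc :: "nat \<Rightarrow> nat \<Rightarrow> real"
    and lam \<mu> \<nu> \<rho> h lt rt :: real
  assumes "DIM('g) = 3"
    and "lie_algebra br"
    and "unimodular_kernel br \<noteq> UNIV"
    and "pseudo_metric g"
    and "nondegenerate_on (unimodular_kernel br) g"
    and "orthonormal_basis g v"
    and "v 1 \<in> unimodular_kernel br" and "v 3 \<in> unimodular_kernel br"
    and "\<And>a. \<epsilon> a = g (v a) (v a)"
    and "br (v 1) (v 3) = 0"
    and "br (v 2) (v 1) = (\<epsilon> 1 * lam) *\<^sub>R v 1 + (\<epsilon> 3 * \<mu>) *\<^sub>R v 3"
    and "br (v 2) (v 3) = (\<epsilon> 1 * \<nu>) *\<^sub>R v 1 + (\<epsilon> 3 * \<rho>) *\<^sub>R v 3"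
    and "\<epsilon> 1 * lam + \<epsilon> 3 * \<rho> \<noteq> 0"
    and "three_form H" and "h = H (v 1) (v 2) (v 3)"
    and "two_form F" and "\<And>x y z. ext_deriv2 br F x y z = 0"
    and "\<And>a b. Fc a b = F (v a) (v b)"
    and "linear \<delta>" and "\<And>A. dc A = \<delta> (induced_basis g v A)"
    and "lt = dc 2 + \<epsilon> 1 * lam" and "rt = dc 2 + \<epsilon> 3 * \<rho>"
  shows "(generalized_einstein (dorfman br H F) (E_minus g) \<delta> \<and>
            case7_relations \<epsilon> lam \<mu> \<nu> \<rho> h Fc dc
          \<longleftrightarrow>
          vanishing_components h Fc dc \<and>
            (condition_i \<epsilon> lt \<mu> \<nu> Fc dc \<or> condition_ii \<epsilon> lt \<mu> \<nu> Fc dc) \<and>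
            common_relations \<epsilon> lt \<mu> \<nu> rt Fc)
       \<and> (vanishing_components h Fc dc \<and> condition_i \<epsilon> lt \<mu> \<nu> Fc dc \<and>
            common_relations \<epsilon> lt \<mu> \<nu> rt Fc
          \<longrightarrow> lie_isomorphic br tau2_plus_R)
       \<and> (vanishing_components h Fc dc \<and> condition_ii \<epsilon> lt \<mu> \<nu> Fc dc \<and>
            common_relations \<epsilon> lt \<mu> \<nu> rt Fc
          \<longrightarrow> lie_isomorphic br tau3_half)"
proof -
  interpret invariant_frame br g F H v
    by unfold_locales fact+
  have \<epsilon>_eq: "\<epsilon> = (\<lambda>a. g (v a) (v a))" and Fc_eq: "Fc = (\<lambda>a b. F (v a) (v b))"
    and dc_eq: "dc = (\<lambda>A. \<delta> (e A))"
    using assms(9,18,20) by blast+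
  have sq: "(\<epsilon> 1)\<^sup>2 = 1" "(\<epsilon> 3)\<^sup>2 = 1"
    using v_sign[of 1] v_sign[of 3] unfolding \<epsilon>_eq by auto
  have lam: "\<epsilon> 1 * lam = lt - dc 2" and rho: "\<epsilon> 3 * \<rho> = rt - dc 2"
    using assms(21,22) by simp_all
  have trace: "lt + rt - 2 * dc 2 \<noteq> 0" using assms(13) lam rho by simp
  let ?families = "vanishing_components h Fc dc \<and>
    (condition_i \<epsilon> lt \<mu> \<nu> Fc dc \<or> condition_ii \<epsilon> lt \<mu> \<nu> Fc dc) \<and> common_relations \<epsilon> lt \<mu> \<nu> rt Fc"
  have families: ?families if c7: "case7_relations \<epsilon> lam \<mu> \<nu> \<rho> h Fc dc"
  proof -
    note c = c7[unfolded case7_relations_def]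
    have nz: "\<mu> \<noteq> 0" "\<nu> \<noteq> 0" "Fc 1 2 \<noteq> 0" "Fc 2 3 \<noteq> 0" using c by blast+
    have "Fc 1 2 * \<epsilon> 3 * (dc 2 + \<epsilon> 1 * lam) = Fc 2 3 * \<nu>"
      "Fc 1 2 * \<mu> = Fc 2 3 * \<epsilon> 1 * (\<epsilon> 3 * \<rho> + dc 2)"
      "(Fc 1 2)\<^sup>2 = \<epsilon> 3 / 2 * (\<nu>\<^sup>2 - \<mu>\<^sup>2) + dc 2 * lam"
      "dc 2 * (\<epsilon> 1 * lam + \<epsilon> 3 * \<rho>) = - lam\<^sup>2 - \<epsilon> 1 * \<epsilon> 3 / 2 * (\<mu> + \<nu>)\<^sup>2 - \<rho>\<^sup>2"
      "Fc 1 2 * Fc 2 3 =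
         \<epsilon> 1 / 2 * lam * (\<nu> - \<mu>) + \<epsilon> 3 / 2 * \<rho> * (\<mu> - \<nu>) - dc 2 / 2 * (\<mu> + \<nu>)"
      using c by blast+
    note fam = family_conditions_if_case7[OF sq assms(21,22,13) nz this]
    have pos: "(Fc 1 2)\<^sup>2 > 0" using nz by simp
    have "condition_i \<epsilon> lt \<mu> \<nu> Fc dc \<or> condition_ii \<epsilon> lt \<mu> \<nu> Fc dc"
      using fam(4)
    proof (elim disjE conjE bexE)
      assume "\<mu> = \<nu>" "dc 2 = lt + \<epsilon> 1 * \<epsilon> 3 * (\<mu>\<^sup>2 / lt)"
        and p: "(Fc 1 2)\<^sup>2 = - (\<mu> / lt)\<^sup>2 * (\<epsilon> 3 * lt\<^sup>2 + \<epsilon> 1 * \<mu>\<^sup>2)"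
      then have "condition_i \<epsilon> lt \<mu> \<nu> Fc dc"
        unfolding condition_i_def using fam(1) nz(1) pos[unfolded p] by (intro conjI) simp_all
      then show ?thesis ..
    next
      fix s :: real
      assume "lt\<^sup>2 \<noteq> \<nu>\<^sup>2" "\<epsilon> 3 = - \<epsilon> 1" and s: "s \<in> {1, -1}" "dc 2 = s / 2 * (\<nu> - \<mu>)"
        "lt\<^sup>2 + s / 2 * (\<nu> - \<mu>) * lt - \<mu> * \<nu> = 0"
        and p: "(Fc 1 2)\<^sup>2 = \<epsilon> 1 * (\<nu> - \<mu>) * \<nu> * (s * (\<mu> / (2 * lt)) - 1)"
      then have "condition_ii \<epsilon> lt \<mu> \<nu> Fc dc"
        unfolding condition_ii_def using fam(1) nz(1) pos[unfolded p] by (intro conjI bexI[of _ s]) simp_all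
      then show ?thesis ..
    qed
    then show ?thesis using c fam(2,3) unfolding common_relations_def by blast
  qed
  have case7: "case7_relations \<epsilon> lam \<mu> \<nu> \<rho> h Fc dc" if f: ?families
  proof -
    have lt0: "lt \<noteq> 0" "\<mu> \<noteq> 0" and p0: "(Fc 1 2)\<^sup>2 > 0" and \<nu>0: "\<nu> \<noteq> 0"
      using f by (auto simp: condition_i_def condition_ii_def)
    have q: "Fc 2 3 = Fc 1 2 * \<epsilon> 3 * (lt / \<nu>)" and r: "rt = \<epsilon> 1 * \<epsilon> 3 * (\<mu> * \<nu> / lt)"
      using f unfolding common_relations_def by blast+
    have fam: "\<mu> = \<nu> \<and> dc 2 = lt + \<epsilon> 1 * \<epsilon> 3 * (\<mu>\<^sup>2 / lt) \<and>
        (Fc 1 2)\<^sup>2 = - (\<mu> / lt)\<^sup>2 * (\<epsilon> 3 * lt\<^sup>2 + \<epsilon> 1 * \<mu>\<^sup>2) \<or>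
      \<epsilon> 3 = - \<epsilon> 1 \<and>
        (\<exists>s\<in>{1, -1}. dc 2 = s / 2 * (\<nu> - \<mu>) \<and> lt\<^sup>2 + s / 2 * (\<nu> - \<mu>) * lt - \<mu> * \<nu> = 0 \<and>
          (Fc 1 2)\<^sup>2 = \<epsilon> 1 * (\<nu> - \<mu>) * \<nu> * (s * (\<mu> / (2 * lt)) - 1))"
      using f unfolding condition_i_def condition_ii_def by blast
    have p: "Fc 1 2 \<noteq> 0" using p0 by auto
    moreover have "Fc 2 3 \<noteq> 0" using q p sq lt0 \<nu>0 by auto
    ultimately show ?thesis
      unfolding case7_relations_def
      using lt0(2) \<nu>0 assms(13) f case7_if_family_conditions[OF sq assms(21,22) lt0 \<nu>0 q r fam]
      by (intro conjI) blast+
  qed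
  have einstein: "generalized_einstein (dorfman br H F) (E_minus g) \<delta>"
    if "case7_relations \<epsilon> lam \<mu> \<nu> \<rho> h Fc dc"
    by (rule case7_generalized_einstein[OF assms(10) assms(11,12)[unfolded \<epsilon>_eq]
          that[unfolded \<epsilon>_eq Fc_eq dc_eq assms(15)] assms(19)])
  \<comment> \<open>\<open>lt + rt - 2 * dc 2\<close> and \<open>dc 2 * (dc 2 - lt - rt)\<close> are trace and determinant of \<open>ad v\<^sub>2\<close>.\<close>
  have iso: "lie_isomorphic br (semidirect_bracket (diag2 1 (\<beta> / \<alpha>)))"
    if "\<nu> \<noteq> 0" "lt + rt - 2 * dc 2 = \<alpha> + \<beta>" "dc 2 * (dc 2 - lt - rt) = \<alpha> * \<beta>"
      "lt * rt = \<epsilon> 1 * \<epsilon> 3 * (\<mu> * \<nu>)" "\<alpha> \<noteq> 0" "\<alpha> \<noteq> \<beta>" for \<alpha> \<beta>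
  proof (rule lie_isomorphic_semidirect_diag[OF assms(1) assms(10-12)])
    show "\<epsilon> 1 * \<nu> \<noteq> 0" using sq that(1) by auto
    show "\<epsilon> 1 * lam + \<epsilon> 3 * \<rho> = \<alpha> + \<beta>" using that(2) lam rho by simp
    show "\<epsilon> 1 * lam * (\<epsilon> 3 * \<rho>) - \<epsilon> 1 * \<nu> * (\<epsilon> 3 * \<mu>) = \<alpha> * \<beta>"
      unfolding lam rho using that(3,4) by (simp add: algebra_simps)
  qed (use that in auto)
  have product: "lt * rt = \<epsilon> 1 * \<epsilon> 3 * (\<mu> * \<nu>)" if "lt \<noteq> 0" "common_relations \<epsilon> lt \<mu> \<nu> rt Fc"
    using that by (simp add: common_relations_def)
  have "lie_isomorphic br tau2_plus_R"
    if i: "condition_i \<epsilon> lt \<mu> \<nu> Fc dc" and c: "common_relations \<epsilon> lt \<mu> \<nu> rt Fc"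
  proof -
    have "dc 2 = lt + rt" and nz: "\<nu> \<noteq> 0" "lt \<noteq> 0"
      using i c by (auto simp: condition_i_def common_relations_def power2_eq_square)
    then show ?thesis
      using iso[of "lt + rt - 2 * dc 2" 0] product[OF nz(2) c] trace by (simp add: tau2_plus_R_def)
  qed
  moreover have "lie_isomorphic br tau3_half"
    if ii: "condition_ii \<epsilon> lt \<mu> \<nu> Fc dc" and c: "common_relations \<epsilon> lt \<mu> \<nu> rt Fc"
  proof -
    have nz: "\<nu> \<noteq> 0" "lt \<noteq> 0" and e31: "\<epsilon> 3 = - \<epsilon> 1"
      using ii by (auto simp: condition_ii_def)
    obtain s where s: "dc 2 = s / 2 * (\<nu> - \<mu>)" "lt\<^sup>2 + s / 2 * (\<nu> - \<mu>) * lt - \<mu> * \<nu> = 0"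
      using ii unfolding condition_ii_def by blast
    have quad: "lt\<^sup>2 + dc 2 * lt - \<mu> * \<nu> = 0" using s(2) unfolding s(1) .
    note prod = product[OF nz(2) c]
    have "lt * (dc 2 + (lt + rt)) = 0" using quad prod e31 sq by algebra
    then have sum: "lt + rt = - dc 2" using nz(2) by simp
    then have d0: "dc 2 \<noteq> 0" using trace by simp
    then have "lie_isomorphic br (semidirect_bracket (diag2 1 (- dc 2 / (- 2 * dc 2))))"
      using sum prod nz by (intro iso) (auto simp: algebra_simps)
    then show ?thesis using d0 by (simp add: tau3_half_def)
  qed
  ultimately show ?thesis using families case7 einstein by blast
qed

end
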